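(* Let $\mathcal{K}$ be a field, let $n\ge1$, $r\ge5$ be integers, and let $\mathcal{R}=\mathcal{K}[\mathcal{M}]$ be the monomial ring attached to $(n,r)$ in the context. Then $\operatorname{reg}(\mathcal{R})=r_Q(\mathcal{R})$, where $Q=(s^{a_n},t^{a_n})\mathcal{R}$.
   Context: Let $\mathcal{K}$ be a field. For integers $n\ge 1$ and $r\ge 5$ put $b_1=r$, $b_2=2r-2$ and $a_i=2r+2i-1$ for $0\le i\le n$. Let $$\mathcal{M}=\{s^{a_n},\ s^{a_n-b_1}t^{b_1},\ s^{a_n-b_2}t^{b_2},\ s^{a_n-a_0}t^{a_0},\ s^{a_n-a_1}t^{a_1},\dots,s^{a_n-a_{n-1}}t^{a_{n-1}},\ t^{a_n}\}\subset\mathcal{K}[s,t],$$ and let $\mathcal{R}=\mathcal{K}[\mathcal{M}]$ be the $\mathcal{K}$-subalgebra of $\mathcal{K}[s,t]$ generated by $\mathcal{M}$, with the standard grading in which the monomials of $\mathcal{M}$ have degree one, and homogeneous maximal ideal $\mathfrak{m}=(\mathcal{M})\mathcal{R}$. The reduction number $r_Q(\mathcal{R})$ is the least nonnegative integer $m$ such that $\mathcal{R}_{m+1}=Q_{m+1}$ (degree $m+1$ components). $\operatorname{reg}(\mathcal{R})=\max\{i+j: H^i_{\mathfrak{m}}(\mathcal{R})_j\neq0\}$ is the Castelnuovo-Mumford regularity. *)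

theory Defs
  imports
    "HOL-Computational_Algebra.Polynomial"
    "HOL-Computational_Algebra.Fraction_Field"
begin

subsection \<open>Localizations and local cohomology of a graded domain\<close>

text \<open>
  A graded domain inside an integral domain is given by its family of homogeneous components
  \<open>A :: int \<Rightarrow> 'a set\<close>. For a nonzero homogeneous element \<open>f\<close> of degree \<open>e\<close>, the
  localization at \<open>f\<close> is the subring of the fraction field consisting of the \<open>x / f ^ k\<close>;
  such an element has degree \<open>j\<close> when \<open>x\<close> has degree \<open>j + k * e\<close>.
\<close>

definition localization_component ::
  "(int \<Rightarrow> 'a::idom set) \<Rightarrow> 'a \<Rightarrow> nat \<Rightarrow> int \<Rightarrow> 'a fract set" where
  "localization_component A f e j = {Fract x (f ^ k) | x k. x \<in> A (j + int (k * e))}"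

text \<open>
  Let \<open>xs\<close> be a list of nonzero elements of degree one. Degree \<open>j\<close> part of the module of
  \<open>i\<close>-cochains of the Cech complex of \<open>xs\<close>: the direct sum, over all \<open>i\<close>-element sets
  \<open>S\<close> of indices, of the localizations at the product of the \<open>xs ! k\<close> with \<open>k \<in> S\<close>
  (an element of degree \<open>card S\<close>). Cochains are extended by zero to all other \<open>S\<close>.
\<close>

definition cech_cochains ::
  "(int \<Rightarrow> 'a::idom set) \<Rightarrow> 'a list \<Rightarrow> nat \<Rightarrow> int \<Rightarrow> (nat set \<Rightarrow> 'a fract) set" where
  "cech_cochains A xs i j =
     {c. \<forall>S. if S \<subseteq> {..<length xs} \<and> card S = i
             then c S \<in> localization_component A (\<Prod>k\<in>S. xs ! k) (card S) j
             else c S = 0}"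

text \<open>The localization maps of the Cech complex are inclusions in the fraction field.\<close>

definition cech_differential ::
  "'a::idom list \<Rightarrow> (nat set \<Rightarrow> 'a fract) \<Rightarrow> nat set \<Rightarrow> 'a fract" where
  "cech_differential xs c S =
     (if S \<subseteq> {..<length xs}
      then \<Sum>k\<in>S. (- 1) ^ card {l \<in> S. l < k} * c (S - {k})
      else 0)"

definition cech_cocycles ::
  "(int \<Rightarrow> 'a::idom set) \<Rightarrow> 'a list \<Rightarrow> nat \<Rightarrow> int \<Rightarrow> (nat set \<Rightarrow> 'a fract) set" where
  "cech_cocycles A xs i j = {c \<in> cech_cochains A xs i j. cech_differential xs c = (\<lambda>S. 0)}"

definition cech_coboundaries ::
  "(int \<Rightarrow> 'a::idom set) \<Rightarrow> 'a list \<Rightarrow> nat \<Rightarrow> int \<Rightarrow> (nat set \<Rightarrow> 'a fract) set" where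
  "cech_coboundaries A xs i j =
     (case i of 0 \<Rightarrow> {\<lambda>S. 0} | Suc i' \<Rightarrow> cech_differential xs ` cech_cochains A xs i' j)"

text \<open>
  Degree \<open>j\<close> component of the \<open>i\<close>-th local cohomology module, supported in the ideal
  generated by \<open>xs\<close>, of the graded ring with components \<open>A\<close>, as the cohomology of the Cech
  complex. It is a quotient group, whose elements are the cosets of the coboundaries in the
  cocycles; hence it vanishes iff the coboundaries are its only element.
\<close>

definition local_cohomology ::
  "(int \<Rightarrow> 'a::idom set) \<Rightarrow> 'a list \<Rightarrow> nat \<Rightarrow> int \<Rightarrow> (nat set \<Rightarrow> 'a fract) set set" where
  "local_cohomology A xs i j =
     cech_cocycles A xs i j //
       {(c, c'). c \<in> cech_cocycles A xs i j \<and> c' \<in> cech_cocycles A xs i j \<and>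
                 (\<lambda>S. c S - c' S) \<in> cech_coboundaries A xs i j}"

definition local_cohomology_nonzero ::
  "(int \<Rightarrow> 'a::idom set) \<Rightarrow> 'a list \<Rightarrow> nat \<Rightarrow> int \<Rightarrow> bool" where
  "local_cohomology_nonzero A xs i j \<longleftrightarrow>
     local_cohomology A xs i j \<noteq> {cech_coboundaries A xs i j}"

definition regularity_degrees :: "(int \<Rightarrow> 'a::idom set) \<Rightarrow> 'a list \<Rightarrow> int set" where
  "regularity_degrees A xs = {int i + j | i j. local_cohomology_nonzero A xs i j}"

text \<open>
  Maximum of the set above; only meaningful if that set has a greatest element. The list
  \<open>xs\<close> has to generate the homogeneous maximal ideal.
\<close>

definition regularity :: "(int \<Rightarrow> 'a::idom set) \<Rightarrow> 'a list \<Rightarrow> int" where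
  "regularity A xs = (GREATEST d. d \<in> regularity_degrees A xs)"


subsection \<open>Reduction number\<close>

text \<open>Only meaningful if some \<open>m\<close> has the property.\<close>

definition reduction_number :: "(int \<Rightarrow> 'a set) \<Rightarrow> 'a set \<Rightarrow> nat" where
  "reduction_number A Q = (LEAST m. A (int m + 1) = Q \<inter> A (int m + 1))"


subsection \<open>The monomial ring\<close>

text \<open>The polynomial ring in \<open>s\<close>, \<open>t\<close> is \<open>'k poly poly\<close>: \<open>s\<close> is the inner variable
  and \<open>t\<close> the outer one.\<close>

definition st_monom :: "nat \<Rightarrow> nat \<Rightarrow> 'k::field poly poly" where
  "st_monom p q = monom (monom 1 p) q"

definition scalar_mult :: "'k::field \<Rightarrow> 'k poly poly \<Rightarrow> 'k poly poly" where
  "scalar_mult c p = smult [:c:] p"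

definition a_exp :: "nat \<Rightarrow> nat \<Rightarrow> nat" where
  "a_exp r i = 2 * r + 2 * i - 1"

definition b1_exp :: "nat \<Rightarrow> nat" where
  "b1_exp r = r"

definition b2_exp :: "nat \<Rightarrow> nat" where
  "b2_exp r = 2 * r - 2"

definition M_gens :: "nat \<Rightarrow> nat \<Rightarrow> 'k::field poly poly list" where
  "M_gens n r =
     [st_monom (a_exp r n) 0,
      st_monom (a_exp r n - b1_exp r) (b1_exp r),
      st_monom (a_exp r n - b2_exp r) (b2_exp r)] @
     map (\<lambda>i. st_monom (a_exp r n - a_exp r i) (a_exp r i)) [0..<n] @
     [st_monom 0 (a_exp r n)]"

inductive_set generated_subalgebra :: "'k::field poly poly set \<Rightarrow> 'k poly poly set"
  for G :: "'k poly poly set" where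
  one: "1 \<in> generated_subalgebra G"
| gen: "x \<in> G \<Longrightarrow> x \<in> generated_subalgebra G"
| scale: "x \<in> generated_subalgebra G \<Longrightarrow> scalar_mult c x \<in> generated_subalgebra G"
| add: "x \<in> generated_subalgebra G \<Longrightarrow> y \<in> generated_subalgebra G \<Longrightarrow>
    x + y \<in> generated_subalgebra G"
| mult: "x \<in> generated_subalgebra G \<Longrightarrow> y \<in> generated_subalgebra G \<Longrightarrow>
    x * y \<in> generated_subalgebra G"

definition R_ring :: "nat \<Rightarrow> nat \<Rightarrow> 'k::field poly poly set" where
  "R_ring n r = generated_subalgebra (set (M_gens n r))"

text \<open>The standard grading: the component of degree \<open>d\<close> is spanned by the products of
  \<open>d\<close> generators; it is zero for negative \<open>d\<close>.\<close>

definition R_component :: "nat \<Rightarrow> nat \<Rightarrow> int \<Rightarrow> 'k::field poly poly set" where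
  "R_component n r d =
     module.span scalar_mult
       {prod_list ms | ms. set ms \<subseteq> set (M_gens n r) \<and> int (length ms) = d}"

definition Q_ideal :: "nat \<Rightarrow> nat \<Rightarrow> 'k::field poly poly set" where
  "Q_ideal n r =
     {x * st_monom (a_exp r n) 0 + y * st_monom 0 (a_exp r n) | x y.
        x \<in> R_ring n r \<and> y \<in> R_ring n r}"

end

theory Submission
  imports Defs "HOL-Library.Multiset"
begin

text \<open>
  The ring \<open>R\<close> is spanned by the monomials \<open>s\<^sup>i t\<^sup>q\<close> of an affine semigroup, and all the invariants in
  the statement can be read off from that semigroup. A monomial of degree \<open>d\<close> is determined by
  its \<open>t\<close>-exponent \<open>e\<close>, because its \<open>s\<close>-exponent is \<open>d D - e\<close> with \<open>D = a\<^sub>n\<close>; it lies in \<open>R\<close> iff \<open>e\<close>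
  is a sum of \<open>d\<close> exponents of generators (\<open>hits d e\<close>). Multiplication by \<open>s\<^sup>D\<close> and by \<open>t\<^sup>D\<close> is the
  passage from \<open>(d, e)\<close> to \<open>(d + 1, e)\<close> and to \<open>(d + 1, e + D)\<close>.

  \<^emph>\<open>Local cohomology.\<close> Inverting one generator \<open>s\<^sup>i t\<^sup>q\<close> with \<open>i, q > 0\<close>, or any two generators, makes all
  generators invertible. So only the localizations at no element, at \<open>s\<^sup>D\<close> and at \<open>t\<^sup>D\<close> are
  special, and the Cech complex has cohomology only in degrees 1 and 2: \<open>H\<^sup>1\<close> lives at the points
  that lie in both special localizations but not in \<open>R\<close>, and \<open>H\<^sup>2\<close> at the points that lie in neither
  (lemma \<open>regularity_degrees_eq\<close>).

  \<^emph>\<open>Reduction number.\<close> As a module over \<open>K[s\<^sup>D, t\<^sup>D]\<close> the ring is minimally generated by the monomials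
  at which \<open>hits\<close> holds but not after division by \<open>s\<^sup>D\<close> or \<open>t\<^sup>D\<close> (predicate \<open>generator\<close>). The reduction
  number is the largest degree of such a generator (lemma \<open>reduction_number_eq\<close>).

  \<^emph>\<open>Comparison.\<close> The residue of \<open>e\<close> modulo \<open>D\<close> splits \<open>R\<close> into monomial ideals of \<open>K[s\<^sup>D, t\<^sup>D]\<close>. A generator
  of degree \<open>m\<close> always forces \<open>H\<^sup>1\<close> in degree \<open>m - 1\<close> or \<open>H\<^sup>2\<close> in degree \<open>m - 2\<close>, and \<open>H\<^sup>2\<close> in
  degree \<open>j\<close> always forces a generator of degree at least \<open>j + 2\<close>. The one implication that can
  fail for a general monomial curve is that \<open>H\<^sup>1\<close> in degree \<open>j\<close> forces a generator of degree at least
  \<open>j + 1\<close>. It holds as soon as \<open>s\<^sup>D t\<^sup>D\<close> annihilates \<open>H\<^sup>1\<close>: two neighbouring generators of one of the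
  monomial ideals then cannot be more than one step apart in both directions
  (theorem \<open>regularity_eq_reduction_number\<close>).

  \<^emph>\<open>The family.\<close> It remains to see that \<open>s\<^sup>D t\<^sup>D\<close> annihilates \<open>H\<^sup>1\<close> (lemma \<open>H1_killed_by_st\<close>). Let \<open>(d, e)\<close>
  lie in both localizations and put \<open>f = d D - e\<close>. The numbers \<open>D - q\<close>, for exponents \<open>q\<close> of
  generators, are even or at least \<open>2 n + 1\<close>, and so is \<open>f\<close>. If \<open>f\<close> is at most about \<open>2 n d\<close>, then
  \<open>e + D\<close> is a sum of \<open>d + 1\<close> numbers \<open>a\<^sub>i\<close>, one of which is replaced by \<open>b\<^sub>2\<close> when \<open>f\<close> is odd. If \<open>f\<close> is large,
  then \<open>e < d (2 r - 1)\<close>; a shortest expression of \<open>e\<close> as a sum of exponents contains so few copies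
  of \<open>b\<^sub>1\<close> and \<open>b\<^sub>2\<close> that it has on average almost \<open>2 r - 1\<close> per summand, whence at most \<open>d + 1\<close>
  summands (lemma \<open>minimal_representation\<close>).
\<close>

section \<open>Sumsets of the exponents\<close>

primrec sumset :: "nat set \<Rightarrow> nat \<Rightarrow> nat set" where
  "sumset E 0 = {0}"
| "sumset E (Suc d) = {a + b | a b. a \<in> E \<and> b \<in> sumset E d}"

lemma sumset_add:
  "a \<in> sumset E d \<Longrightarrow> b \<in> sumset E d' \<Longrightarrow> a + b \<in> sumset E (d + d')"
proof (induction d arbitrary: a)
  case (Suc d)
  then obtain x y where "a = x + y" "x \<in> E" "y \<in> sumset E d" by auto
  then show ?case using Suc.IH[of y] Suc.prems(2) by (auto simp: add.assoc)
qed simp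

text \<open>Multisets of summands allow an exchange of some summands for others with the same sum.\<close>
lemma sumset_iff_mset:
  "e \<in> sumset E d \<longleftrightarrow> (\<exists>M. set_mset M \<subseteq> E \<and> size M = d \<and> sum_mset M = e)"
proof (induction d arbitrary: e)
  case (Suc d)
  show ?case
  proof
    assume "e \<in> sumset E (Suc d)"
    then obtain a b where ab: "e = a + b" "a \<in> E" "b \<in> sumset E d" by auto
    then obtain M where "set_mset M \<subseteq> E" "size M = d" "sum_mset M = b" using Suc.IH by blast
    then show "\<exists>M. set_mset M \<subseteq> E \<and> size M = Suc d \<and> sum_mset M = e"
      using ab by (intro exI[of _ "add_mset a M"]) auto
  next
    assume "\<exists>M. set_mset M \<subseteq> E \<and> size M = Suc d \<and> sum_mset M = e"
    then obtain M where M: "set_mset M \<subseteq> E" "size M = Suc d" "sum_mset M = e" by blast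
    then obtain a M' where "M = add_mset a M'" by (metis size_eq_Suc_imp_eq_union)
    then have "a \<in> E" "sum_mset M' \<in> sumset E d" "e = a + sum_mset M'"
      using M Suc.IH[of "sum_mset M'"] by auto
    then show "e \<in> sumset E (Suc d)" by auto
  qed
qed auto

lemma sumset_le: "(\<And>a. a \<in> E \<Longrightarrow> a \<le> D) \<Longrightarrow> e \<in> sumset E d \<Longrightarrow> e \<le> d * D"
  by (induction d arbitrary: e) (force intro: add_mono)+

lemma sumset_mult: "a \<in> E \<Longrightarrow> k * a \<in> sumset E k"
  by (induction k) auto

text \<open>
  Two consecutive exponents make the group generated by the points \<open>(1, a)\<close>, \<open>a \<in> E\<close>, all of
  \<open>\<int>\<^sup>2\<close>.
\<close>
locale curve_exponents =
  fixes E :: "nat set" and D :: nat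
  assumes finite_E: "finite E" and zero_in_E: "0 \<in> E" and D_in_E: "D \<in> E"
    and E_le: "\<And>e. e \<in> E \<Longrightarrow> e \<le> D" and D_pos: "0 < D"
    and consecutive: "\<exists>a\<in>E. Suc a \<in> E"
begin

text \<open>
  The point \<open>(d, e)\<close> stands for the monomial \<open>s\<^bsup>d D - e\<^esup> t\<^sup>e\<close>. Both coordinates are integers because the
  points of the localizations may have negative ones.
\<close>
definition hits :: "int \<Rightarrow> int \<Rightarrow> bool" where
  "hits d e \<longleftrightarrow> 0 \<le> d \<and> 0 \<le> e \<and> nat e \<in> sumset E (nat d)"

text \<open>The monomials of the localizations at \<open>s\<^sup>D\<close> (\<open>s_hits\<close>) and at \<open>t\<^sup>D\<close> (\<open>t_hits\<close>).\<close>
definition s_hits :: "int \<Rightarrow> int \<Rightarrow> bool" where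
  "s_hits j e \<longleftrightarrow> (\<exists>k. hits (j + int k) e)"

definition t_hits :: "int \<Rightarrow> int \<Rightarrow> bool" where
  "t_hits j e \<longleftrightarrow> (\<exists>k. hits (j + int k) (e + int k * int D))"

text \<open>Minimal generators over the subring generated by \<open>s\<^sup>D\<close> and \<open>t\<^sup>D\<close>.\<close>
definition generator :: "int \<Rightarrow> int \<Rightarrow> bool" where
  "generator d e \<longleftrightarrow> hits d e \<and> \<not> hits (d - 1) e \<and> \<not> hits (d - 1) (e - int D)"

lemma hits_nonneg: "hits d e \<Longrightarrow> 0 \<le> d \<and> 0 \<le> e"
  by (simp add: hits_def)

lemma hits_le: "hits d e \<Longrightarrow> e \<le> d * int D"
proof -
  assume "hits d e"
  then have "nat e \<le> nat d * D" "0 \<le> d" "0 \<le> e" using sumset_le[of E D] E_le by (auto simp: hits_def)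
  then have "int (nat e) \<le> int (nat d) * int D" by (metis of_nat_le_iff of_nat_mult)
  then show ?thesis using \<open>0 \<le> d\<close> \<open>0 \<le> e\<close> by simp
qed

lemma hits_add: "hits d e \<Longrightarrow> hits d' e' \<Longrightarrow> hits (d + d') (e + e')"
  using sumset_add[of "nat e" E "nat d" "nat e'" "nat d'"] by (auto simp: hits_def nat_add_distrib)

lemma hits_mult: "a \<in> E \<Longrightarrow> hits (int k) (int k * int a)"
  using sumset_mult[of a E k] by (simp add: hits_def flip: of_nat_mult)

lemma hits_s: "hits d e \<Longrightarrow> 0 \<le> k \<Longrightarrow> hits (d + k) e"
  using hits_add[of d e k 0] hits_mult[OF zero_in_E, of "nat k"] by simp

lemma hits_t: "hits d e \<Longrightarrow> 0 \<le> k \<Longrightarrow> hits (d + k) (e + k * int D)"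
  using hits_add[of d e k "k * int D"] hits_mult[OF D_in_E, of "nat k"] by simp

lemma s_hitsI: "hits d e \<Longrightarrow> s_hits j e"
proof -
  assume h: "hits d e"
  show ?thesis
  proof (cases "j \<le> d")
    case True
    then show ?thesis using h unfolding s_hits_def by (intro exI[of _ "nat (d - j)"]) simp
  next
    case False
    then show ?thesis using hits_s[OF h, of "j - d"] unfolding s_hits_def
      by (intro exI[of _ 0]) simp
  qed
qed

lemma t_hitsI: "hits (j + k) (e + k * int D) \<Longrightarrow> t_hits j e"
proof -
  assume h: "hits (j + k) (e + k * int D)"
  show ?thesis
  proof (cases "0 \<le> k")
    case True
    then show ?thesis using h unfolding t_hits_def by (intro exI[of _ "nat k"]) simp
  next
    case False
    then show ?thesis using hits_t[OF h, of "- k"] unfolding t_hits_def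
      by (intro exI[of _ 0]) simp
  qed
qed

text \<open>Inverting both \<open>s\<^sup>D\<close> and \<open>t\<^sup>D\<close> yields all Laurent monomials of integral degree.\<close>
lemma eventually_hits: "\<exists>K. hits (j + 2 * int K) (e + int K * int D)"
proof -
  obtain a where a: "a \<in> E" "Suc a \<in> E" using consecutive by blast
  define f where "f = nat (e mod int D)"
  have f: "e = int f + e div int D * int D" using D_pos by (simp add: f_def)
  \<comment> \<open>\<open>f\<close> copies of \<open>a + 1\<close> among \<open>D * f\<close> summands give a sum congruent to \<open>e\<close> modulo \<open>D\<close>\<close>
  define l where "l = int (f * a) - e div int D"
  have "hits (int f + int (D * f - f)) (int f * int (Suc a) + int (D * f - f) * int a)"
    by (intro hits_add hits_mult a)
  moreover have "int (D * f - f) = int D * int f - int f"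
    using D_pos by (simp add: of_nat_diff)
  ultimately have h: "hits (int D * int f) (e + l * int D)"
    by (subst f) (simp add: l_def algebra_simps)
  \<comment> \<open>the surplus of degree over \<open>j\<close>; it and \<open>l\<close> are filled up with powers of \<open>s\<^sup>D\<close> and \<open>t\<^sup>D\<close> to \<open>2 K\<close> and \<open>K\<close>\<close>
  define k where "k = int D * int f - j"
  define K where "K = nat (max l (k - l))"
  have K: "l \<le> int K" "k - l \<le> int K" by (auto simp: K_def)
  have "hits (int D * int f + (int K - l)) (e + l * int D + (int K - l) * int D)"
    by (rule hits_t[OF h]) (use K in simp)
  then have "hits (int D * int f + (int K - l) + (int K - (k - l)))
      (e + l * int D + (int K - l) * int D)"
    by (rule hits_s) (use K in simp)
  moreover have "int D * int f + (int K - l) + (int K - (k - l)) = j + 2 * int K"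
    by (simp add: k_def)
  moreover have "e + l * int D + (int K - l) * int D = e + int K * int D"
    by (simp add: algebra_simps)
  ultimately show ?thesis by auto
qed

text \<open>
  A point \<open>(m, p)\<close> strictly between the two boundary rays has a multiple that is a sum of
  \<open>(1, 0)\<close> and \<open>(1, D)\<close> with positive coefficients, namely
  \<open>D (m, p) = (m D - p) (1, 0) + p (1, D)\<close>. Inverting it therefore inverts \<open>s\<^sup>D\<close> and \<open>t\<^sup>D\<close>.
\<close>
lemma eventually_hits_interior:
  assumes p: "0 < p" "p < m * int D"
  shows "\<exists>k. hits (j + int k * m) (e + int k * p)"
proof -
  obtain K where K: "hits (j + 2 * int K) (e + int K * int D)" using eventually_hits by blast
  have pos: "0 \<le> int K * (p - 1)" "0 \<le> int K * (m * int D - p - 1)"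
    using p by auto
  \<comment> \<open>the \<open>D\<close>-fold of \<open>K (m, p)\<close> contains \<open>K (1, 0) + K (1, D)\<close>; the rest is added next\<close>
  let ?k = "K * D"
  have "hits (j + 2 * int K + int K * (p - 1)) (e + int K * int D + int K * (p - 1) * int D)"
    by (rule hits_t[OF K pos(1)])
  then have "hits (j + 2 * int K + int K * (p - 1) + int K * (m * int D - p - 1))
      (e + int K * int D + int K * (p - 1) * int D)"
    by (rule hits_s[OF _ pos(2)])
  moreover have "j + 2 * int K + int K * (p - 1) + int K * (m * int D - p - 1) = j + int ?k * m"
    "e + int K * int D + int K * (p - 1) * int D = e + int ?k * p"
    by (simp_all add: algebra_simps)
  ultimately have "hits (j + int ?k * m) (e + int ?k * p)" by (simp only:)
  then show ?thesis by blast
qed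

text \<open>
  A generator has no summand \<open>0\<close> and no summand repeated \<open>D\<close> times: \<open>D\<close> copies of \<open>a > 0\<close> can be
  exchanged for copies of \<open>D\<close> and \<open>0\<close>, of which at least one is \<open>D\<close>.
\<close>
lemma generator_bounded: "\<exists>B. \<forall>d e. generator d e \<longrightarrow> d \<le> B"
proof (intro exI allI impI)
  fix d e assume g: "generator d e"
  then have "nat e \<in> sumset E (nat d)" "0 \<le> d" "0 \<le> e" by (auto simp: generator_def hits_def)
  then obtain M where M: "set_mset M \<subseteq> E" "size M = nat d" "sum_mset M = nat e"
    by (auto simp: sumset_iff_mset)
  have "count M a < D + 1" if "a \<in> E" for a
  proof (rule ccontr)
    assume c: "\<not> count M a < D + 1"
    consider "a = 0" | "0 < a" by auto
    then show False
    proof cases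
      case 1
      then obtain M' where M': "M = add_mset 0 M'" using c
        by (metis count_eq_zero_iff multi_member_split zero_less_Suc Suc_eq_plus1)
      then have "hits (d - 1) e"
        using M \<open>0 \<le> d\<close> \<open>0 \<le> e\<close> by (auto simp: hits_def sumset_iff_mset nat_diff_distrib intro!: exI[of _ M'])
      then show False using g by (simp add: generator_def)
    next
      case 2
      \<comment> \<open>\<open>D\<close> copies of \<open>a\<close> have the sum of \<open>a\<close> copies of \<open>D\<close> and \<open>D - a\<close> copies of \<open>0\<close>\<close>
      have "replicate_mset D a \<subseteq># M" using c by (simp flip: count_le_replicate_mset_subset_eq)
      then obtain M' where M': "M = replicate_mset D a + M'" by (auto simp: mset_subset_eq_exists_conv)
      have "hits (d - 1) (e - int D)"
        unfolding hits_def sumset_iff_mset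
      proof (intro conjI exI)
        let ?M = "replicate_mset (a - 1) D + replicate_mset (D - a) 0 + M'"
        have "a \<le> D" using E_le that by simp
        have e: "nat e = D * a + sum_mset M'" using M(3) M' by simp
        have "D \<le> D * a" using 2 by simp
        then show "0 \<le> e - int D" using e \<open>0 \<le> e\<close> by linarith
        show "set_mset ?M \<subseteq> E" using M(1) M' zero_in_E D_in_E by (auto split: if_splits)
        have "size M = D + size M'" using M' by simp
        then show "0 \<le> d - 1" "size ?M = nat (d - 1)"
          using M(2) D_pos 2 \<open>a \<le> D\<close> by auto
        have "sum_mset ?M = (a - 1) * D + sum_mset M'" by simp
        also have "\<dots> = D * a + sum_mset M' - D"
          using 2 by (cases a) (auto simp: algebra_simps)
        finally show "sum_mset ?M = nat (e - int D)" using e \<open>0 \<le> e\<close> by linarith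
      qed
      then show False using g by (simp add: generator_def)
    qed
  qed
  then have "(\<Sum>a\<in>E. count M a) \<le> (\<Sum>a\<in>E. D)" by (intro sum_mono) force
  moreover have "size M = (\<Sum>a\<in>E. count M a)"
    unfolding size_multiset_overloaded_eq
    using M(1) finite_E by (intro sum.mono_neutral_left) (auto simp: not_in_iff)
  ultimately have "nat d \<le> card E * D" using M(2) by simp
  then show "d \<le> int (card E * D)" by linarith
qed

text \<open>Omit one summand: if the remaining point were reducible, so would be the whole.\<close>
lemma generator_predecessor:
  assumes "generator (d + 1) e" "0 \<le> d"
  shows "\<exists>e. generator d e"
proof -
  have "nat e \<in> sumset E (nat (d + 1))" "0 \<le> e" using assms by (auto simp: generator_def hits_def)
  then have "nat e \<in> sumset E (Suc (nat d))" using assms(2) by (simp add: nat_add_distrib)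
  then obtain a b where ab: "nat e = a + b" "a \<in> E" "b \<in> sumset E (nat d)" by auto
  have e: "e = int b + int a" using ab(1) \<open>0 \<le> e\<close> by linarith
  have a: "hits 1 (int a)" using hits_mult[OF ab(2), of 1] by simp
  have "hits d (int b)" using ab assms by (simp add: hits_def)
  moreover have "\<not> hits (d - 1) (int b)"
    using hits_add[OF _ a, of "d - 1" "int b"] assms(1) by (auto simp: generator_def e)
  moreover have "\<not> hits (d - 1) (int b - int D)"
    using hits_add[OF _ a, of "d - 1" "int b - int D"] assms(1)
    by (auto simp: generator_def e algebra_simps)
  ultimately show ?thesis unfolding generator_def by blast
qed

lemma generator_zero: "generator 0 0"
  using hits_mult[OF zero_in_E, of 0] by (auto simp: generator_def dest: hits_nonneg)

definition top_degree :: int where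
  "top_degree = (GREATEST d. \<exists>e. generator d e)"

lemma top_degree:
  shows generator_top_degree: "\<exists>e. generator top_degree e"
    and generator_le_top_degree: "generator d e \<Longrightarrow> d \<le> top_degree"
    and top_degree_nonneg: "0 \<le> top_degree"
proof -
  obtain B where B: "\<And>d e. generator d e \<Longrightarrow> d \<le> B" using generator_bounded by blast
  have nonneg: "0 \<le> d" if "generator d e" for d e using that hits_nonneg by (auto simp: generator_def)
  let ?P = "\<lambda>m. \<exists>e. generator (int m) e"
  have P0: "?P 0" using generator_zero by auto
  have Pb: "\<forall>m. ?P m \<longrightarrow> m \<le> nat B" using B by (force simp: le_nat_iff)
  define m where "m = Greatest ?P"
  have m: "?P m" unfolding m_def by (rule GreatestI_nat[of ?P 0 "nat B"]) (use P0 Pb in auto)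
  have le: "d \<le> int m" if "generator d e" for d e
  proof -
    have "?P (nat d)" using that nonneg[OF that] by auto
    then have "nat d \<le> m" unfolding m_def using Pb by (intro Greatest_le_nat) auto
    then show ?thesis by simp
  qed
  have "top_degree = int m" unfolding top_degree_def using m le by (intro Greatest_equality) auto
  then show "\<exists>e. generator top_degree e" "generator d e \<Longrightarrow> d \<le> top_degree" "0 \<le> top_degree"
    using m le by auto
qed

lemma generators_in_all_lower_degrees: "int m \<le> top_degree \<Longrightarrow> \<exists>e. generator (int m) e"
proof (induction "nat top_degree - m" arbitrary: m)
  case 0
  then have "int m = top_degree" by linarith
  then show ?case using generator_top_degree by simp
next
  case (Suc k)
  then have "\<exists>e. generator (int (Suc m)) e" by (intro Suc.hyps(1)) linarith+
  then show ?case using generator_predecessor[of "int m"] by (auto simp: add.commute)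
qed

text \<open>
  Move from the point \<open>(j, e)\<close> in the direction of \<open>s\<^sup>D\<close>, and in that of \<open>t\<^sup>D\<close>, until the semigroup is
  reached. If neither end point is a generator, then the assumption \<open>kill\<close> applies to the quotient of
  \<open>(j, e)\<close> by \<open>s\<^sup>D t\<^sup>D\<close>, and \<open>(j, e)\<close> itself lies in the semigroup.
\<close>
lemma H1_degree_le_top_degree:
  assumes kill: "\<And>d e. s_hits d e \<Longrightarrow> t_hits d e \<Longrightarrow> hits (d + 2) (e + int D)"
    and j: "s_hits j e" "t_hits j e" "\<not> hits j e"
  shows "j + 1 \<le> top_degree"
proof -
  define k where "k = (LEAST k. hits (j + int k) e)"
  define l where "l = (LEAST l. hits (j + int l) (e + int l * int D))"
  have k: "hits (j + int k) e" and l: "hits (j + int l) (e + int l * int D)"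
    using j(1,2) unfolding s_hits_def t_hits_def k_def l_def by (auto intro: LeastI_ex)
  have pos: "0 < k" "0 < l" using k l j(3) by (auto intro: gr0I)
  have k': "\<not> hits (j + int k - 1) e"
    using not_less_Least[of "k - 1" "\<lambda>k. hits (j + int k) e"] pos k_def
    by (auto simp: of_nat_diff add_diff_eq)
  have l': "\<not> hits (j + int l - 1) (e + int l * int D - int D)"
    using not_less_Least[of "l - 1" "\<lambda>l. hits (j + int l) (e + int l * int D)"] pos l_def
    by (auto simp: of_nat_diff algebra_simps)
  have "generator (j + int k) e \<or> generator (j + int l) (e + int l * int D)"
  proof (rule ccontr)
    assume "\<not> ?thesis"
    then have c: "hits (j + int k - 1) (e - int D)" "hits (j + int l - 1) (e + int l * int D)"
      using k l k' l' by (auto simp: generator_def)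
    have "s_hits (j - 2) (e - int D)" using c(1) by (rule s_hitsI)
    moreover have "t_hits (j - 2) (e - int D)"
      by (rule t_hitsI[of _ "int l + 1"]) (use c(2) in \<open>simp add: algebra_simps\<close>)
    ultimately show False using kill[of "j - 2" "e - int D"] j(3) by simp
  qed
  then show ?thesis using generator_le_top_degree pos by force
qed

text \<open>
  Since \<open>(j, e)\<close> lies in neither localization, every semigroup point congruent to \<open>e\<close> modulo \<open>D\<close>
  exceeds it by at least one step in each of the two directions, in particular a point of least
  degree, which is a generator.
\<close>
lemma H2_degree_le_top_degree:
  assumes j: "\<not> s_hits j e" "\<not> t_hits j e"
  shows "j + 2 \<le> top_degree"
proof -
  obtain K where K: "hits (j + 2 * int K) (e + int K * int D)" using eventually_hits by blast
  let ?P = "\<lambda>m. \<exists>b. hits (int m) (e + b * int D)"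
  define m where "m = Least ?P"
  have "?P (nat (j + 2 * int K))" using K hits_nonneg by force
  then have "?P m" unfolding m_def by (rule LeastI)
  then obtain b where b: "hits (int m) (e + b * int D)" by blast
  have minimal: "\<not> hits (int m - 1) (e + b' * int D)" for b'
  proof
    assume h: "hits (int m - 1) (e + b' * int D)"
    then have "?P (m - 1)" "0 < m" using hits_nonneg[OF h] by (auto simp: of_nat_diff)
    then show False using not_less_Least[of "m - 1" ?P] m_def by simp
  qed
  have "generator (int m) (e + b * int D)"
    using b minimal[of b] minimal[of "b - 1"] by (simp add: generator_def algebra_simps)
  then have "int m \<le> top_degree" by (rule generator_le_top_degree)
  moreover have "1 \<le> b"
  proof (rule ccontr)
    assume "\<not> 1 \<le> b"
    then have "hits (int m + (- b)) (e + b * int D + (- b) * int D)" by (intro hits_t[OF b]) simp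
    then have "hits (int m - b) e" by (simp add: algebra_simps)
    then show False using s_hitsI j(1) by blast
  qed
  moreover have "j + b + 1 \<le> int m"
  proof (rule ccontr)
    assume "\<not> j + b + 1 \<le> int m"
    then have "hits (int m + (j + b - int m)) (e + b * int D)" by (intro hits_s[OF b]) simp
    then have "t_hits j e" by (intro t_hitsI[of j b]) simp
    then show False using j(2) by blast
  qed
  ultimately show ?thesis by linarith
qed

text \<open>
  Divide the generator by \<open>s\<^sup>D t\<^sup>D\<close>. If the quotient lies in neither localization, it is a point
  of \<open>H\<^sup>2\<close>. If it lies in the localization at \<open>s\<^sup>D\<close>, then the quotient by \<open>t\<^sup>D\<close> is a point of \<open>H\<^sup>1\<close>,
  and symmetrically.
\<close>
lemma generator_gives_cohomology:
  assumes g: "generator m e"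
  shows "(\<exists>e. s_hits (m - 1) e \<and> t_hits (m - 1) e \<and> \<not> hits (m - 1) e) \<or>
         (\<exists>e. \<not> s_hits (m - 2) e \<and> \<not> t_hits (m - 2) e)"
proof -
  have h: "hits m e" "\<not> hits (m - 1) e" "\<not> hits (m - 1) (e - int D)"
    using g by (auto simp: generator_def)
  consider (s) "s_hits (m - 2) (e - int D)" | (t) "t_hits (m - 2) (e - int D)"
    | (none) "\<not> s_hits (m - 2) (e - int D)" "\<not> t_hits (m - 2) (e - int D)" by blast
  then show ?thesis
  proof cases
    case s
    then have "s_hits (m - 1) (e - int D)" unfolding s_hits_def[of "m - 2"] using s_hitsI by blast
    moreover have "t_hits (m - 1) (e - int D)"
      by (rule t_hitsI[of _ 1]) (use h in simp)
    ultimately show ?thesis using h(3) by blast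
  next
    case t
    then obtain k where k: "hits (m - 2 + int k) (e - int D + int k * int D)"
      by (auto simp: t_hits_def)
    have "t_hits (m - 1) e"
      by (rule t_hitsI[of _ "int k - 1"]) (use k in \<open>simp add: algebra_simps\<close>)
    moreover have "s_hits (m - 1) e" using h(1) by (rule s_hitsI)
    ultimately show ?thesis using h(2) by blast
  qed blast
qed

end

section \<open>The Cech complex of a ring with two boundary rays\<close>

text \<open>
  The terms for \<open>(k, l)\<close> and \<open>(l, k)\<close> cancel. In characteristic two a sum equal to its own negative
  need not vanish, hence the separation of the pairs with \<open>l < k\<close> from those with \<open>k < l\<close>.
\<close>
lemma cech_differential_squared:
  "cech_differential xs (cech_differential xs c) = (\<lambda>S. 0)"
proof
  fix S
  define s :: "nat \<Rightarrow> nat set \<Rightarrow> 'a fract" where "s k T = (- 1) ^ card {l \<in> T. l < k}" for k T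
  show "cech_differential xs (cech_differential xs c) S = 0"
  proof (cases "S \<subseteq> {..<length xs}")
    case True
    then have fin: "finite S" by (rule finite_subset) simp
    define f where "f k l = s k S * (s l (S - {k}) * c (S - {k} - {l}))" for k l
    have less: "f l k = - f k l" if "k \<in> S" "l \<in> S" "l < k" for k l
    proof -
      have "{m \<in> S - {k}. m < l} = {m \<in> S. m < l}" using that by auto
      moreover have "{m \<in> S. m < k} = insert l {m \<in> S - {l}. m < k}" using that by auto
      then have "card {m \<in> S. m < k} = Suc (card {m \<in> S - {l}. m < k})" using fin by simp
      ultimately have "s l (S - {k}) = s l S" "s k S = - s k (S - {l})"
        by (simp_all add: s_def)
      moreover have "S - {k} - {l} = S - {l} - {k}" by auto
      ultimately show ?thesis by (simp add: f_def)
    qed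
    define P where "P = {(k, l). k \<in> S \<and> l \<in> S \<and> l < k}"
    define P' where "P' = {(k, l). k \<in> S \<and> l \<in> S \<and> k < l}"
    have fins: "finite P" "finite P'"
      using fin by (auto simp: P_def P'_def intro: finite_subset[of _ "S \<times> S"])
    have "cech_differential xs (cech_differential xs c) S
        = (\<Sum>k\<in>S. \<Sum>l\<in>S - {k}. f k l)"
      using True
      by (auto simp: cech_differential_def f_def s_def sum_distrib_left intro!: sum.cong)
    also have "\<dots> = (\<Sum>(k, l)\<in>(SIGMA k:S. S - {k}). f k l)"
      using fin by (subst sum.Sigma) auto
    also have "(SIGMA k:S. S - {k}) = P \<union> P'" by (auto simp: P_def P'_def)
    also have "(\<Sum>(k, l)\<in>P \<union> P'. f k l) = (\<Sum>(k, l)\<in>P. f k l) + (\<Sum>(k, l)\<in>P'. f k l)"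
      using fins by (intro sum.union_disjoint) (auto simp: P_def P'_def)
    also have "(\<Sum>(k, l)\<in>P'. f k l) = (\<Sum>(k, l)\<in>P. f l k)"
      by (rule sum.reindex_bij_witness[of _ prod.swap prod.swap]) (auto simp: P_def P'_def)
    also have "\<dots> = (\<Sum>(k, l)\<in>P. - f k l)"
      by (rule sum.cong) (auto simp: P_def less)
    also have "\<dots> = - (\<Sum>(k, l)\<in>P. f k l)" by (simp add: sum_negf[symmetric] case_prod_beta)
    finally show ?thesis by simp
  qed (simp add: cech_differential_def)
qed

lemma cech_differential_singleton:
  "a < length xs \<Longrightarrow> cech_differential xs c {a} = c {}"
proof -
  have "{l. l = a \<and> l < a} = {}" by auto
  then have "card {l. l = a \<and> l < a} = 0" by (simp only: card.empty)
  note this[simp]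
  show "a < length xs \<Longrightarrow> cech_differential xs c {a} = c {}"
    by (simp add: cech_differential_def)
qed

lemma cech_differential_pair:
  assumes "a < b" "b < length xs"
  shows "cech_differential xs c {a, b} = c {b} - c {a}"
proof -
  have "{l \<in> {a, b}. l < a} = {}" "{l \<in> {a, b}. l < b} = {a}"
    "{a, b} - {b} = {a}" "{a, b} - {a} = {b}" using assms by auto
  then have "(\<Sum>k\<in>{a, b}. (- 1) ^ card {l \<in> {a, b}. l < k} * c ({a, b} - {k})) = c {b} - c {a}"
    using assms by (subst sum.insert) (simp_all only: sum.insert sum.empty finite.intros
      empty_iff insert_iff card.empty card_1_singleton_iff, simp_all)
  then show ?thesis using assms by (simp add: cech_differential_def)
qed

lemma cech_differential_diff:
  "cech_differential xs (\<lambda>S. c S - c' S) S = cech_differential xs c S - cech_differential xs c' S"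
  by (simp add: cech_differential_def right_diff_distrib sum_subtractf)

text \<open>
  The cone construction with apex the index \<open>0\<close>, which always carries the sign \<open>1\<close>. It is a
  preimage of every cocycle as long as the values of cochains are unrestricted; whether it is an
  admissible cochain is decided by the localizations.
\<close>
lemma cech_differential_contraction:
  fixes c :: "nat set \<Rightarrow> 'a::idom fract"
  assumes "0 < length xs" and cocycle: "cech_differential xs c = (\<lambda>S. 0)"
    and zero: "\<And>S. \<not> S \<subseteq> {..<length xs} \<Longrightarrow> c S = 0"
  shows "cech_differential xs (\<lambda>S. if 0 \<in> S then 0 else c (insert 0 S)) = c"
proof
  fix S
  let ?h = "\<lambda>S. if 0 \<in> S then 0 else c (insert 0 S)"
  show "cech_differential xs ?h S = c S"
  proof (cases "S \<subseteq> {..<length xs}")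
    case sub: True
    then have fin: "finite S" by (rule finite_subset) simp
    show ?thesis
    proof (cases "0 \<in> S")
      case True
      have "cech_differential xs ?h S
          = (\<Sum>k\<in>S. (- 1) ^ card {l \<in> S. l < k} * ?h (S - {k}))"
        using sub by (simp add: cech_differential_def)
      also have "\<dots> = (\<Sum>k\<in>{0}. (- 1) ^ card {l \<in> S. l < k} * ?h (S - {k}))"
        by (rule sum.mono_neutral_right) (use True fin in auto)
      also have "\<dots> = c S" using True by (simp add: insert_absorb)
      finally show ?thesis .
    next
      case False
      have pos: "0 < k" if "k \<in> S" for k using that False by (cases k) auto
      have "0 = cech_differential xs c (insert 0 S)" by (simp add: cocycle)
      also have "\<dots> = (\<Sum>k\<in>insert 0 S. (- 1) ^ card {l \<in> insert 0 S. l < k} * c (insert 0 S - {k}))"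
        using sub assms(1) unfolding cech_differential_def by (intro if_P) auto
      also have "\<dots> = c S + (\<Sum>k\<in>S. (- 1) ^ card {l \<in> insert 0 S. l < k} * c (insert 0 S - {k}))"
        using fin False by (subst sum.insert) auto
      also have "(\<Sum>k\<in>S. (- 1) ^ card {l \<in> insert 0 S. l < k} * c (insert 0 S - {k}))
          = (\<Sum>k\<in>S. - ((- 1) ^ card {l \<in> S. l < k} * ?h (S - {k})))"
      proof (rule sum.cong[OF refl])
        fix k assume k: "k \<in> S"
        have "{l \<in> insert 0 S. l < k} = insert 0 {l \<in> S. l < k}" using pos[OF k] by auto
        then have "card {l \<in> insert 0 S. l < k} = Suc (card {l \<in> S. l < k})"
          using fin False by simp
        moreover have "insert 0 S - {k} = insert 0 (S - {k})" using pos[OF k] by auto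
        ultimately show "(- 1) ^ card {l \<in> insert 0 S. l < k} * c (insert 0 S - {k})
            = - ((- 1) ^ card {l \<in> S. l < k} * ?h (S - {k}))"
          using False by simp
      qed
      also have "\<dots> = - cech_differential xs ?h S"
        using sub by (simp add: cech_differential_def sum_negf)
      finally show ?thesis by simp
    qed
  qed (simp add: cech_differential_def zero)
qed

text \<open>
  The model is a set of monomials in a two-dimensional cone, of which only the first and the last lie
  on the boundary rays: all localizations coincide except those at no element, at the first
  and at the last one.
\<close>
locale two_ended_cech =
  fixes A :: "int \<Rightarrow> 'a::idom set" and xs :: "'a list" and j :: int
    and loc :: "nat set \<Rightarrow> 'a fract set" and N :: nat
  assumes loc_def: "loc S = localization_component A (\<Prod>k\<in>S. xs ! k) (card S) j"
    and length_xs: "length xs = Suc N" and N_ge_2: "2 \<le> N"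
    and loc_zero: "S \<subseteq> {..N} \<Longrightarrow> 0 \<in> loc S"
    and loc_diff: "S \<subseteq> {..N} \<Longrightarrow> x \<in> loc S \<Longrightarrow> y \<in> loc S \<Longrightarrow> x - y \<in> loc S"
    and loc_mono: "S \<subseteq> T \<Longrightarrow> T \<subseteq> {..N} \<Longrightarrow> loc S \<subseteq> loc T"
    and loc_saturated: "S \<subseteq> {..N} \<Longrightarrow> S \<notin> {{}, {0}, {N}} \<Longrightarrow> loc S = loc {0, N}"
begin

lemma lessThan_length: "{..<length xs} = {..N}"
  by (auto simp: length_xs)

lemma cech_cochains_iff:
  "c \<in> cech_cochains A xs i j \<longleftrightarrow>
    (\<forall>S. (S \<subseteq> {..N} \<and> card S = i \<longrightarrow> c S \<in> loc S) \<and> (\<not> (S \<subseteq> {..N} \<and> card S = i) \<longrightarrow> c S = 0))"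
  by (auto simp: cech_cochains_def loc_def lessThan_length)

lemma cochain_in_loc:
  "c \<in> cech_cochains A xs i j \<Longrightarrow> S \<subseteq> {..N} \<Longrightarrow> card S = i \<Longrightarrow> c S \<in> loc S"
  unfolding cech_cochains_iff by blast

lemma cochain_eq_zero:
  "c \<in> cech_cochains A xs i j \<Longrightarrow> \<not> (S \<subseteq> {..N} \<and> card S = i) \<Longrightarrow> c S = 0"
  unfolding cech_cochains_iff by blast

lemma loc_uminus: "S \<subseteq> {..N} \<Longrightarrow> x \<in> loc S \<Longrightarrow> - x \<in> loc S"
  using loc_diff[of S 0 x] loc_zero[of S] by simp

lemma loc_add: "S \<subseteq> {..N} \<Longrightarrow> x \<in> loc S \<Longrightarrow> y \<in> loc S \<Longrightarrow> x + y \<in> loc S"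
  using loc_diff[of S x "- y"] loc_uminus[of S y] by simp

lemma loc_sum: "S \<subseteq> {..N} \<Longrightarrow> (\<And>k. k \<in> B \<Longrightarrow> f k \<in> loc S) \<Longrightarrow> sum f B \<in> loc S"
  by (induction B rule: infinite_finite_induct) (auto simp: loc_zero loc_add)

lemma differential_eq_zero:
  assumes "\<And>S. card S \<noteq> i \<Longrightarrow> c S = 0" "card S \<noteq> Suc i"
  shows "cech_differential xs c S = 0"
proof -
  have "c (S - {k}) = 0" if "k \<in> S" "S \<subseteq> {..N}" for k
  proof (rule assms(1))
    from that have "finite S" by (meson finite_atMost finite_subset)
    then have "card S = Suc (card (S - {k}))" using that by (intro card.remove)
    then show "card (S - {k}) \<noteq> i" using assms(2) by auto
  qed
  then show ?thesis by (auto simp: cech_differential_def lessThan_length intro!: sum.neutral)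
qed

lemma differential_in_cochains:
  assumes "c \<in> cech_cochains A xs i j"
  shows "cech_differential xs c \<in> cech_cochains A xs (Suc i) j"
  unfolding cech_cochains_iff
proof (intro allI conjI impI)
  fix S
  assume S: "S \<subseteq> {..N} \<and> card S = Suc i"
  then have fin: "finite S" by (meson finite_atMost finite_subset)
  have "(- 1) ^ card {l \<in> S. l < k} * c (S - {k}) \<in> loc S" if "k \<in> S" for k
  proof -
    have "card (S - {k}) = i" "S - {k} \<subseteq> {..N}" using that S fin by (simp, blast)
    then have "c (S - {k}) \<in> loc (S - {k})" using cochain_in_loc[OF assms, of "S - {k}"] by simp
    then have "c (S - {k}) \<in> loc S" using loc_mono[of "S - {k}" S] S by (meson Diff_subset subsetD)
    then show ?thesis using S
      by (cases "even (card {l \<in> S. l < k})") (simp_all add: loc_uminus)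
  qed
  then show "cech_differential xs c S \<in> loc S"
    using S by (simp add: cech_differential_def lessThan_length loc_sum)
next
  fix S
  assume S: "\<not> (S \<subseteq> {..N} \<and> card S = Suc i)"
  show "cech_differential xs c S = 0"
  proof (cases "S \<subseteq> {..N}")
    case True
    show ?thesis
    proof (rule differential_eq_zero)
      show "c S = 0" if "card S \<noteq> i" for S
        by (rule cochain_eq_zero[OF assms]) (simp add: that)
    qed (use S True in simp)
  qed (simp add: cech_differential_def lessThan_length)
qed

lemma zero_in_cochains: "(\<lambda>S. 0) \<in> cech_cochains A xs i j"
  unfolding cech_cochains_iff using loc_zero by blast

lemma diff_in_cochains:
  "c \<in> cech_cochains A xs i j \<Longrightarrow> c' \<in> cech_cochains A xs i j \<Longrightarrow>
    (\<lambda>S. c S - c' S) \<in> cech_cochains A xs i j"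
  unfolding cech_cochains_iff using loc_diff by simp

lemma zero_in_cocycles: "(\<lambda>S. 0) \<in> cech_cocycles A xs i j"
  using zero_in_cochains[of i] by (auto simp: cech_cocycles_def cech_differential_def)

lemma diff_in_cocycles:
  "c \<in> cech_cocycles A xs i j \<Longrightarrow> c' \<in> cech_cocycles A xs i j \<Longrightarrow>
    (\<lambda>S. c S - c' S) \<in> cech_cocycles A xs i j"
  by (auto simp: cech_cocycles_def diff_in_cochains cech_differential_diff fun_eq_iff)

lemma zero_in_coboundaries: "(\<lambda>S. 0) \<in> cech_coboundaries A xs i j"
proof (cases i)
  case (Suc i')
  have "(\<lambda>S. 0) = cech_differential xs (\<lambda>S. 0 :: 'a fract)" by (auto simp: cech_differential_def)
  then show ?thesis using zero_in_cochains[of i'] Suc by (auto simp: cech_coboundaries_def)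
qed (simp add: cech_coboundaries_def)

lemma coboundaries_subset_cocycles:
  "cech_coboundaries A xs i j \<subseteq> cech_cocycles A xs i j"
proof (cases i)
  case 0
  then show ?thesis using zero_in_cocycles by (auto simp: cech_coboundaries_def)
next
  case (Suc i')
  then show ?thesis
    by (auto simp: cech_coboundaries_def cech_cocycles_def differential_in_cochains
        cech_differential_squared)
qed

text \<open>
  If every cocycle is a coboundary, the only coset is the set of all cocycles. It equals the set of
  coboundaries because, conversely, coboundaries are cocycles.
\<close>
lemma local_cohomology_nonzero_iff:
  "local_cohomology_nonzero A xs i j \<longleftrightarrow>
    \<not> cech_cocycles A xs i j \<subseteq> cech_coboundaries A xs i j"
proof -
  let ?Z = "cech_cocycles A xs i j" and ?B = "cech_coboundaries A xs i j"
  let ?r = "{(c, c'). c \<in> ?Z \<and> c' \<in> ?Z \<and> (\<lambda>S. c S - c' S) \<in> ?B}"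
  have "?Z // ?r = {?B} \<longleftrightarrow> ?Z \<subseteq> ?B"
  proof
    assume eq: "?Z // ?r = {?B}"
    show "?Z \<subseteq> ?B"
    proof
      fix c assume c: "c \<in> ?Z"
      then have "?r `` {c} \<in> ?Z // ?r" by (rule quotientI)
      then have "?r `` {c} = ?B" using eq by blast
      then show "c \<in> ?B" using c zero_in_coboundaries by auto
    qed
  next
    assume "?Z \<subseteq> ?B"
    then have ZB: "?Z = ?B" using coboundaries_subset_cocycles by blast
    have "?r `` {c} = ?B" if "c \<in> ?Z" for c
      using that diff_in_cocycles ZB by auto
    then show "?Z // ?r = {?B}"
      using zero_in_cocycles[of i] unfolding quotient_def by blast
  qed
  then show ?thesis by (simp add: local_cohomology_nonzero_def local_cohomology_def)
qed

lemma local_cohomology_0: "\<not> local_cohomology_nonzero A xs 0 j"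
  unfolding local_cohomology_nonzero_iff not_not
proof
  fix c assume c: "c \<in> cech_cocycles A xs 0 j"
  have "c S = 0" for S
  proof (cases "S = {}")
    case True
    have "c {} = cech_differential xs c {0}"
      using length_xs by (simp add: cech_differential_singleton)
    then show ?thesis using c True by (simp add: cech_cocycles_def)
  next
    case False
    then have "\<not> (S \<subseteq> {..N} \<and> card S = 0)" using finite_subset by fastforce
    then show ?thesis using c cochain_eq_zero[of c _ S] unfolding cech_cocycles_def by blast
  qed
  then show "c \<in> cech_coboundaries A xs 0 j" by (auto simp: cech_coboundaries_def)
qed

text \<open>
  The cone over a cocycle of degree at least three has its values at index sets with two or more elements,
  where all localizations are equal; so it is a cochain.
\<close>
lemma local_cohomology_ge_3:
  assumes "3 \<le> i"
  shows "\<not> local_cohomology_nonzero A xs i j"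
  unfolding local_cohomology_nonzero_iff not_not
proof
  fix c assume c: "c \<in> cech_cocycles A xs i j"
  obtain i' where i: "i = Suc i'" "2 \<le> i'" using assms by (cases i) auto
  define h where "h S = (if 0 \<in> S then 0 else c (insert 0 S))" for S
  have cc: "c \<in> cech_cochains A xs i j" and dc: "cech_differential xs c = (\<lambda>S. 0)"
    using c by (auto simp: cech_cocycles_def)
  have saturated: "loc S = loc {0, N}" if "S \<subseteq> {..N}" "2 \<le> card S" for S
    using that by (intro loc_saturated) auto
  have "h \<in> cech_cochains A xs i' j"
    unfolding cech_cochains_iff
  proof (intro allI conjI impI)
    fix S assume S: "S \<subseteq> {..N} \<and> card S = i'"
    then have fin: "finite S" by (meson finite_atMost finite_subset)
    show "h S \<in> loc S"
    proof (cases "0 \<in> S")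
      case False
      then have "insert 0 S \<subseteq> {..N}" "card (insert 0 S) = i" using S fin i by auto
      then have "c (insert 0 S) \<in> loc (insert 0 S)" using cc cochain_in_loc by blast
      then show ?thesis
        using False S i saturated[of S] saturated[of "insert 0 S"] \<open>card (insert 0 S) = i\<close>
        by (simp add: h_def)
    qed (use S loc_zero in \<open>simp add: h_def\<close>)
  next
    fix S assume S: "\<not> (S \<subseteq> {..N} \<and> card S = i')"
    show "h S = 0"
    proof (cases "0 \<in> S")
      case False
      have "\<not> (insert 0 S \<subseteq> {..N} \<and> card (insert 0 S) = i)"
      proof
        assume a: "insert 0 S \<subseteq> {..N} \<and> card (insert 0 S) = i"
        then have "finite S" by (meson finite_atMost finite_subset insert_subset)
        with a False S i show False by simp
      qed
      then show ?thesis using cochain_eq_zero[OF cc] False by (simp add: h_def)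
    qed (simp add: h_def)
  qed
  moreover have "cech_differential xs h = c"
    unfolding h_def using cc dc length_xs
    by (intro cech_differential_contraction cochain_eq_zero[OF cc]) (auto simp: lessThan_length)
  ultimately show "c \<in> cech_coboundaries A xs i j"
    using i by (auto simp: cech_coboundaries_def)
qed

text \<open>
  A cocycle of degree one takes the same value at all indices, which is subject to the
  conditions at the two ends only; it is a coboundary iff that value lies in the ring itself.
\<close>
lemma local_cohomology_1:
  "local_cohomology_nonzero A xs 1 j \<longleftrightarrow> \<not> loc {0} \<inter> loc {N} \<subseteq> loc {}"
  unfolding local_cohomology_nonzero_iff not_not
proof (intro arg_cong[where f = Not] iffI subsetI)
  fix w assume ZB: "cech_cocycles A xs 1 j \<subseteq> cech_coboundaries A xs 1 j"
    and w: "w \<in> loc {0} \<inter> loc {N}"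
  define c where "c S = (if S \<subseteq> {..N} \<and> card S = 1 then w else 0)" for S
  have "c \<in> cech_cochains A xs 1 j"
    unfolding cech_cochains_iff
  proof (intro allI conjI impI)
    fix S assume S: "S \<subseteq> {..N} \<and> card S = 1"
    then obtain k where k: "S = {k}" "k \<le> N" by (auto simp: card_1_singleton_iff)
    show "c S \<in> loc S"
    proof (cases "S \<in> {{}, {0}, {N}}")
      case False
      then have "loc S = loc {0, N}" using S by (intro loc_saturated) auto
      then show ?thesis using w loc_mono[of "{0}" "{0, N}"] S by (auto simp: c_def)
    qed (use w k in \<open>auto simp: c_def\<close>)
  qed (auto simp: c_def)
  moreover have "cech_differential xs c S = 0" for S
  proof (cases "S \<subseteq> {..N} \<and> card S = 2")
    case True
    then obtain a b where "S = {a, b}" "a < b"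
      by (metis card_2_iff insert_commute linorder_neqE_nat)
    then show ?thesis using True
      by (simp add: cech_differential_pair length_xs c_def)
  next
    case False
    have "S \<subseteq> {..N} \<Longrightarrow> cech_differential xs c S = 0"
      using False by (intro differential_eq_zero[of 1]) (auto simp: c_def)
    then show ?thesis by (cases "S \<subseteq> {..N}") (simp_all add: cech_differential_def lessThan_length)
  qed
  ultimately have "c \<in> cech_cocycles A xs 1 j" by (auto simp: cech_cocycles_def)
  then obtain h where h: "h \<in> cech_cochains A xs 0 j" "c = cech_differential xs h"
    using ZB by (auto simp: cech_coboundaries_def)
  have "w = h {}"
    using fun_cong[OF h(2), of "{0}"] length_xs by (simp add: cech_differential_singleton c_def)
  then show "w \<in> loc {}" using h(1) cochain_in_loc[of h 0 "{}"] by simp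
next
  fix c assume sub: "loc {0} \<inter> loc {N} \<subseteq> loc {}" and c: "c \<in> cech_cocycles A xs 1 j"
  have eq: "c {k} = c {0}" if "k \<le> N" for k
  proof (cases "k = 0")
    case False
    then have "c {k} - c {0} = cech_differential xs c {0, k}"
      using that length_xs by (intro cech_differential_pair[symmetric]) auto
    then show ?thesis using c by (simp add: cech_cocycles_def)
  qed simp
  have "c {0} \<in> loc {0}" "c {N} \<in> loc {N}" using c cochain_in_loc[of c 1]
    by (auto simp: cech_cocycles_def)
  then have w: "c {0} \<in> loc {}" using sub eq[of N] by auto
  define h where "h S = (if S = {} then c {0} else 0)" for S :: "nat set"
  have "h \<in> cech_cochains A xs 0 j"
    using w by (auto simp: cech_cochains_iff h_def dest: finite_subset)
  moreover have "cech_differential xs h S = c S" for S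
  proof (cases "S \<subseteq> {..N} \<and> card S = 1")
    case True
    then obtain k where "S = {k}" "k \<le> N" by (auto simp: card_1_singleton_iff)
    then show ?thesis using length_xs
      by (simp add: cech_differential_singleton h_def eq[of k])
  next
    case False
    then have "c S = 0" using c cochain_eq_zero[of c _ S] unfolding cech_cocycles_def by blast
    moreover have "cech_differential xs h S = 0"
    proof (cases "S \<subseteq> {..N}")
      case True
      then show ?thesis using False by (intro differential_eq_zero[of 0]) (auto simp: h_def)
    qed (simp add: cech_differential_def lessThan_length)
    ultimately show ?thesis by simp
  qed
  ultimately show "c \<in> cech_coboundaries A xs 1 j"
    by (auto simp: cech_coboundaries_def intro!: image_eqI[of _ _ h])
qed

text \<open>
  Every cocycle \<open>c\<close> is the differential of the cone \<open>g\<close>, and the only possibly inadmissible value of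
  \<open>g\<close> is \<open>c {0, N}\<close> at the last index. Subtraction of a constant \<open>u\<close> repairs it iff \<open>u\<close> is
  allowed at the first index and \<open>c {0, N} - u\<close> at the last.
\<close>
lemma local_cohomology_2:
  "local_cohomology_nonzero A xs 2 j \<longleftrightarrow> \<not> loc {0, N} \<subseteq> {u + v | u v. u \<in> loc {0} \<and> v \<in> loc {N}}"
  unfolding local_cohomology_nonzero_iff not_not
proof (intro arg_cong[where f = Not] iffI subsetI)
  fix w assume ZB: "cech_cocycles A xs 2 j \<subseteq> cech_coboundaries A xs 2 j"
    and w: "w \<in> loc {0, N}"
  define g where "g S = (if \<exists>k. 0 < k \<and> k \<le> N \<and> S = {k} then w else 0)" for S :: "nat set"
  define c where "c = cech_differential xs g"
  have "c \<in> cech_cochains A xs 2 j"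
    unfolding cech_cochains_iff
  proof (intro allI conjI impI)
    fix S assume S: "S \<subseteq> {..N} \<and> card S = 2"
    then obtain a b where ab: "S = {a, b}" "a < b"
      by (metis card_2_iff insert_commute linorder_neqE_nat)
    have "loc S = loc {0, N}" using S by (intro loc_saturated) auto
    moreover have "c S = g {b} - g {a}"
      using ab S by (simp add: c_def cech_differential_pair length_xs)
    ultimately show "c S \<in> loc S"
      using w loc_diff[of "{0, N}"] loc_zero[of "{0, N}"] by (auto simp: g_def)
  next
    fix S assume S: "\<not> (S \<subseteq> {..N} \<and> card S = 2)"
    show "c S = 0"
    proof (cases "S \<subseteq> {..N}")
      case True
      then show ?thesis using S unfolding c_def
        by (intro differential_eq_zero[of 1]) (auto simp: g_def)
    qed (simp add: c_def cech_differential_def lessThan_length)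
  qed
  then have "c \<in> cech_cocycles A xs 2 j"
    by (simp add: cech_cocycles_def c_def cech_differential_squared)
  then obtain h where h: "h \<in> cech_cochains A xs 1 j" "c = cech_differential xs h"
    using ZB by (auto simp: cech_coboundaries_def numeral_2_eq_2)
  have "c {0, N} = w"
    using N_ge_2 by (simp add: c_def cech_differential_pair length_xs g_def)
  moreover have "c {0, N} = h {N} - h {0}"
    using N_ge_2 by (simp add: h(2) cech_differential_pair length_xs)
  ultimately have "w = - h {0} + h {N}" by simp
  moreover have "- h {0} \<in> loc {0}" "h {N} \<in> loc {N}"
    using cochain_in_loc[OF h(1)] by (auto intro: loc_uminus)
  ultimately show "w \<in> {u + v | u v. u \<in> loc {0} \<and> v \<in> loc {N}}" by blast
next
  fix c assume sub: "loc {0, N} \<subseteq> {u + v | u v. u \<in> loc {0} \<and> v \<in> loc {N}}"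
    and c: "c \<in> cech_cocycles A xs 2 j"
  have cc: "c \<in> cech_cochains A xs 2 j" and dc: "cech_differential xs c = (\<lambda>S. 0)"
    using c by (auto simp: cech_cocycles_def)
  have "c {0, N} \<in> loc {0, N}" using cochain_in_loc[OF cc, of "{0, N}"] N_ge_2 by simp
  then obtain u v where uv: "c {0, N} = u + v" "u \<in> loc {0}" "v \<in> loc {N}" using sub by blast
  define g where "g S = (if 0 \<in> S then 0 else c (insert 0 S))" for S
  define e where "e S = (if S \<subseteq> {..N} \<and> card S = 1 then u else 0)" for S
  define h where "h S = g S - e S" for S
  have dg: "cech_differential xs g = c"
    unfolding g_def using cc dc length_xs
    by (intro cech_differential_contraction cochain_eq_zero[OF cc]) (auto simp: lessThan_length)
  have de: "cech_differential xs e S = 0" for S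
  proof (cases "S \<subseteq> {..N} \<and> card S = 2")
    case True
    then obtain a b where "S = {a, b}" "a < b"
      by (metis card_2_iff insert_commute linorder_neqE_nat)
    then show ?thesis using True
      by (simp add: cech_differential_pair length_xs e_def)
  next
    case False
    have "S \<subseteq> {..N} \<Longrightarrow> cech_differential xs e S = 0"
      using False by (intro differential_eq_zero[of 1]) (auto simp: e_def)
    then show ?thesis by (cases "S \<subseteq> {..N}") (simp_all add: cech_differential_def lessThan_length)
  qed
  have "h \<in> cech_cochains A xs 1 j"
    unfolding cech_cochains_iff
  proof (intro allI conjI impI)
    fix S assume S: "S \<subseteq> {..N} \<and> card S = 1"
    then obtain k where k: "S = {k}" "k \<le> N" by (auto simp: card_1_singleton_iff)
    consider "k = 0" | "k = N" "k \<noteq> 0" | "k \<noteq> 0" "k \<noteq> N" by blast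
    then show "h S \<in> loc S"
    proof cases
      case 1
      then show ?thesis using k uv by (simp add: h_def g_def e_def loc_uminus)
    next
      case 2
      then show ?thesis using k uv by (simp add: h_def g_def e_def)
    next
      case 3
      have eqs: "loc {k} = loc {0, N}" "loc {0, k} = loc {0, N}"
        using 3 k by (auto intro!: loc_saturated)
      have "c {0, k} \<in> loc {0, k}" using cochain_in_loc[OF cc, of "{0, k}"] 3 k by simp
      moreover have "u \<in> loc {0, N}" using uv(2) loc_mono[of "{0}" "{0, N}"] by auto
      ultimately show ?thesis using 3 k eqs by (simp add: h_def g_def e_def loc_diff)
    qed
  next
    fix S assume S: "\<not> (S \<subseteq> {..N} \<and> card S = 1)"
    have "g S = 0"
    proof (cases "0 \<in> S")
      case False
      have "\<not> (insert 0 S \<subseteq> {..N} \<and> card (insert 0 S) = 2)"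
      proof
        assume a: "insert 0 S \<subseteq> {..N} \<and> card (insert 0 S) = 2"
        then have "finite S" by (meson finite_atMost finite_subset insert_subset)
        with a False S show False by simp
      qed
      then show ?thesis using cochain_eq_zero[OF cc] False by (simp add: g_def)
    qed (simp add: g_def)
    then show "h S = 0" using S by (auto simp: h_def e_def)
  qed
  moreover have "cech_differential xs h = c"
    by (rule ext) (simp add: h_def[abs_def] cech_differential_diff dg de)
  ultimately show "c \<in> cech_coboundaries A xs 2 j"
    by (auto simp: cech_coboundaries_def numeral_2_eq_2)
qed

end

section \<open>Polynomials in s and t and their monomials\<close>

lemma module_scalar_mult: "module (scalar_mult :: 'k::field \<Rightarrow> 'k poly poly \<Rightarrow> 'k poly poly)"
proof
  fix a b :: 'k and x :: "'k poly poly"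
  show "scalar_mult (a + b) x = scalar_mult a x + scalar_mult b x"
    unfolding scalar_mult_def by (simp flip: smult_add_left)
  show "scalar_mult a (scalar_mult b x) = scalar_mult (a * b) x"
    by (simp add: scalar_mult_def mult.commute)
  show "scalar_mult 1 x = x"
    unfolding scalar_mult_def by (simp flip: one_pCons)
qed (simp add: scalar_mult_def smult_add_right)

lemma st_monom_mult: "st_monom a b * st_monom c d = st_monom (a + c) (b + d)"
  by (simp add: st_monom_def mult_monom)

lemma st_monom_0: "st_monom 0 0 = 1"
  by (simp add: st_monom_def)

lemma st_monom_power: "st_monom a b ^ k = st_monom (k * a) (k * b)"
  by (induction k) (simp_all add: st_monom_mult st_monom_0)

lemma st_monom_nonzero [simp]: "st_monom a b \<noteq> 0"
  by (simp add: st_monom_def monom_eq_0_iff)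

lemma coeff_st_monom: "coeff (coeff (st_monom a b) q) i = (if q = b \<and> i = a then 1 else 0)"
  by (auto simp: st_monom_def)

lemma coeff_st_monom_mult:
  "coeff (coeff (st_monom a b * x) q) i = (if b \<le> q \<and> a \<le> i then coeff (coeff x (q - b)) (i - a) else 0)"
  by (auto simp: st_monom_def coeff_monom_mult)

lemma coeff_scalar_mult: "coeff (coeff (scalar_mult c x) q) i = c * coeff (coeff x q) i"
  by (simp add: scalar_mult_def)

lemma scalar_mult_mult: "scalar_mult c x * y = scalar_mult c (x * y)" "y * scalar_mult c x = scalar_mult c (y * x)"
  by (simp_all add: scalar_mult_def)

lemma scalar_mult_one: "scalar_mult 1 x = x"
  by (rule module.scale_one[OF module_scalar_mult])

lemma sum_of_monoms:
  "x = (\<Sum>q\<le>degree x. \<Sum>i\<le>degree (coeff x q). scalar_mult (coeff (coeff x q) i) (st_monom i q))"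
proof -
  have "(\<Sum>i\<le>degree (coeff x q). scalar_mult (coeff (coeff x q) i) (st_monom i q)) = monom (coeff x q) q" for q
  proof -
    have "monom (coeff x q) q = monom (\<Sum>i\<le>degree (coeff x q). monom (coeff (coeff x q) i) i) q"
      by (simp add: poly_as_sum_of_monoms)
    also have "\<dots> = (\<Sum>i\<le>degree (coeff x q). monom (monom (coeff (coeff x q) i) i) q)"
      by (rule poly_eqI) (simp add: coeff_sum)
    also have "\<dots> = (\<Sum>i\<le>degree (coeff x q). scalar_mult (coeff (coeff x q) i) (st_monom i q))"
      by (simp add: scalar_mult_def st_monom_def smult_monom)
    finally show ?thesis ..
  qed
  then show ?thesis by (simp add: poly_as_sum_of_monoms)
qed

text \<open>A polynomial is a combination of the monomials of its support, with finitely many terms.\<close>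
lemma in_span_of_support:
  assumes "\<And>i q. coeff (coeff x q) i \<noteq> 0 \<Longrightarrow> st_monom i q \<in> B"
  shows "x \<in> module.span scalar_mult B"
proof -
  interpret module scalar_mult by (rule module_scalar_mult)
  have "scalar_mult (coeff (coeff x q) i) (st_monom i q) \<in> span B" for i q
    by (cases "coeff (coeff x q) i = 0") (simp_all add: span_zero span_scale span_base assms)
  then show ?thesis by (subst sum_of_monoms) (intro span_sum)
qed

text \<open>
  Clear denominators and compare the coefficients of the monomial on the left: one of the two summands on
  the right has to contribute. This is how points of the semigroup are recovered from elements of the
  fraction field.
\<close>
lemma monom_eq_sum_of_fractions:
  fixes x y :: "'k::field poly poly"
  assumes "Fract (st_monom a b) (st_monom a' b') = Fract x (st_monom u v) + Fract y (st_monom u' v')"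
  shows "b' \<le> b + v \<and> coeff (coeff x (b + v - b')) (a + u - a') \<noteq> 0 \<or>
         b' \<le> b + v' \<and> coeff (coeff y (b + v' - b')) (a + u' - a') \<noteq> 0"
proof -
  have "st_monom a b * (st_monom u v * st_monom u' v') =
      (x * st_monom u' v' + y * st_monom u v) * st_monom a' b'"
    using assms by (simp add: eq_fract)
  moreover have ring: "(x * s' + y * s) * m = s' * m * x + s * m * y" for s s' m :: "'k poly poly"
    by (simp add: algebra_simps)
  ultimately have eq: "st_monom (a + (u + u')) (b + (v + v')) =
      st_monom (u' + a') (v' + b') * x + st_monom (u + a') (v + b') * y"
    by (simp only: ring st_monom_mult)
  have "coeff (coeff (st_monom (u' + a') (v' + b') * x) (b + (v + v'))) (a + (u + u'))
      + coeff (coeff (st_monom (u + a') (v + b') * y) (b + (v + v'))) (a + (u + u')) = 1"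
    by (simp add: coeff_st_monom flip: coeff_add eq)
  then have "coeff (coeff (st_monom (u' + a') (v' + b') * x) (b + (v + v'))) (a + (u + u')) \<noteq> 0
      \<or> coeff (coeff (st_monom (u + a') (v + b') * y) (b + (v + v'))) (a + (u + u')) \<noteq> 0"
    by (metis add_0 zero_neq_one)
  moreover have "b + (v + v') - (v' + b') = b + v - b'" "a + (u + u') - (u' + a') = a + u - a'"
    "b + (v + v') - (v + b') = b + v' - b'" "a + (u + u') - (u + a') = a + u' - a'"
    by simp_all
  ultimately show ?thesis by (simp only: coeff_st_monom_mult split: if_splits) auto
qed


section \<open>The coordinate ring of a projective monomial curve\<close>

text \<open>
  The exponents are kept in a list because the Cech complex refers to generators by their index.
\<close>
locale projective_monomial_curve =
  fixes es :: "nat list" and D :: nat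
  assumes length_es: "3 \<le> length es"
    and first: "es ! 0 = 0" and last: "es ! (length es - 1) = D"
    and interior: "\<And>k. 0 < k \<Longrightarrow> k < length es - 1 \<Longrightarrow> 0 < es ! k \<and> es ! k < D"
    and consecutive_es: "\<exists>a\<in>set es. Suc a \<in> set es"
begin

lemma es_le: "k < length es \<Longrightarrow> es ! k \<le> D"
proof -
  assume "k < length es"
  then consider "k = 0" | "k = length es - 1" | "0 < k" "k < length es - 1" by linarith
  then show ?thesis using first last interior[of k] by cases simp_all
qed

lemma D_positive: "0 < D"
proof -
  have "1 < length es - 1" using length_es by linarith
  then show ?thesis using interior[of 1] by simp
qed

sublocale curve_exponents "set es" D
proof
  show "0 \<in> set es" using first length_es by (metis nth_mem order_less_le_trans zero_less_numeral)
  show "D \<in> set es" using last length_es nth_mem[of "length es - 1" es] by simp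
  show "e \<le> D" if "e \<in> set es" for e using that es_le by (auto simp: in_set_conv_nth)
qed (use D_positive consecutive_es in auto)

definition gens :: "'k::field poly poly list" where
  "gens = map (\<lambda>e. st_monom (D - e) e) es"

text \<open>
  The \<open>nat\<close> conversions are exact, because \<open>hits d e\<close> implies \<open>0 \<le> e \<le> d D\<close>; in negative degree
  the set is empty.
\<close>
definition monoms :: "int \<Rightarrow> 'k::field poly poly set" where
  "monoms d = {st_monom (nat (d * int D - e)) (nat e) | e. hits d e}"

definition component :: "int \<Rightarrow> 'k::field poly poly set" where
  "component d = module.span scalar_mult {prod_list ms | ms. set ms \<subseteq> set gens \<and> int (length ms) = d}"

definition curve_ring :: "'k::field poly poly set" where
  "curve_ring = generated_subalgebra (set gens)"

definition end_ideal :: "'k::field poly poly set" where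
  "end_ideal = {x * st_monom D 0 + y * st_monom 0 D | x y. x \<in> curve_ring \<and> y \<in> curve_ring}"

lemma prod_gens_sumset:
  "(\<exists>ms. set ms \<subseteq> set gens \<and> length ms = d \<and> prod_list ms = (x :: 'k::field poly poly)) \<longleftrightarrow>
    (\<exists>e\<in>sumset (set es) d. x = st_monom (d * D - e) e)"
proof (induction d arbitrary: x)
  case 0
  show ?case by (auto simp: st_monom_0)
next
  case (Suc d)
  have step: "st_monom (D - a) a * st_monom (d * D - b) b = (st_monom (Suc d * D - (a + b)) (a + b) :: 'k poly poly)"
    if "a \<in> set es" "b \<in> sumset (set es) d" for a b
    using E_le[OF that(1)] sumset_le[OF E_le that(2)] by (simp add: st_monom_mult)
  show ?case
  proof
    assume "\<exists>ms. set ms \<subseteq> set gens \<and> length ms = Suc d \<and> prod_list ms = x"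
    then obtain m ms where ms: "m \<in> set gens" "set ms \<subseteq> set gens" "length ms = d" "x = m * prod_list ms"
      by (auto simp: length_Suc_conv)
    then obtain b where "b \<in> sumset (set es) d" "prod_list ms = st_monom (d * D - b) b"
      using Suc.IH[of "prod_list ms"] by blast
    moreover obtain a where "a \<in> set es" "m = st_monom (D - a) a" using ms(1) by (auto simp: gens_def)
    ultimately show "\<exists>e\<in>sumset (set es) (Suc d). x = st_monom (Suc d * D - e) e"
      using ms(4) step by (intro bexI[of _ "a + b"]) auto
  next
    assume "\<exists>e\<in>sumset (set es) (Suc d). x = st_monom (Suc d * D - e) e"
    then obtain a b where ab: "a \<in> set es" "b \<in> sumset (set es) d"
      "x = st_monom (Suc d * D - (a + b)) (a + b)" by auto
    then obtain ms where "set ms \<subseteq> set gens" "length ms = d" "prod_list ms = (st_monom (d * D - b) b :: 'k poly poly)"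
      using Suc.IH[of "st_monom (d * D - b) b"] by blast
    then show "\<exists>ms. set ms \<subseteq> set gens \<and> length ms = Suc d \<and> prod_list ms = x"
      using ab step by (intro exI[of _ "st_monom (D - a) a # ms"]) (auto simp: gens_def)
  qed
qed

lemma products_eq_monoms:
  "{prod_list ms | ms. set ms \<subseteq> set (gens :: 'k::field poly poly list) \<and> int (length ms) = d} = monoms d"
proof (intro set_eqI iffI)
  fix x :: "'k poly poly"
  assume "x \<in> {prod_list ms | ms. set ms \<subseteq> set gens \<and> int (length ms) = d}"
  then obtain ms where ms: "set ms \<subseteq> set gens" "int (length ms) = d" "prod_list ms = x" by blast
  then obtain e where "e \<in> sumset (set es) (length ms)" "x = st_monom (length ms * D - e) e"
    using prod_gens_sumset[of "length ms" x] by blast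
  moreover have "nat (d * int D - int e) = length ms * D - e"
    unfolding ms(2)[symmetric] by (simp add: nat_diff_distrib' nat_mult_distrib)
  ultimately show "x \<in> monoms d"
    using ms(2) by (auto simp: monoms_def hits_def intro!: exI[of _ "int e"])
next
  fix x :: "'k poly poly"
  assume "x \<in> monoms d"
  then obtain e where e: "hits d e" "x = st_monom (nat (d * int D - e)) (nat e)" by (auto simp: monoms_def)
  have "nat (d * int D - e) = nat d * D - nat e"
    using hits_nonneg[OF e(1)] by (simp add: nat_diff_distrib' nat_mult_distrib)
  then have "\<exists>e\<in>sumset (set es) (nat d). x = st_monom (nat d * D - e) e"
    using e by (auto simp: hits_def)
  then obtain ms where "set ms \<subseteq> set gens" "length ms = nat d" "prod_list ms = x"
    unfolding prod_gens_sumset[symmetric] by blast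
  moreover have "0 \<le> d" using hits_nonneg[OF e(1)] by simp
  ultimately show "x \<in> {prod_list ms | ms. set ms \<subseteq> set gens \<and> int (length ms) = d}"
    by (intro CollectI exI[of _ ms]) simp
qed

lemma component_eq_span: "component d = module.span scalar_mult (monoms d)"
  by (simp add: component_def products_eq_monoms)

lemma component_support:
  assumes "x \<in> component d" "coeff (coeff x q) i \<noteq> 0"
  shows "hits d (int q) \<and> int i + int q = d * int D"
proof -
  interpret module "scalar_mult :: 'a \<Rightarrow> 'a poly poly \<Rightarrow> 'a poly poly" by (rule module_scalar_mult)
  have "\<forall>q i. coeff (coeff x q) i \<noteq> 0 \<longrightarrow> hits d (int q) \<and> int i + int q = d * int D"
    using assms(1) unfolding component_eq_span
  proof (induction rule: span_induct_alt)
    case (step c y z)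
    from step(1) obtain e where e: "hits d e" "y = st_monom (nat (d * int D - e)) (nat e)"
      by (auto simp: monoms_def)
    have "coeff (coeff y q) i \<noteq> 0 \<or> coeff (coeff z q) i \<noteq> 0"
      if "coeff (coeff (scalar_mult c y + z) q) i \<noteq> 0" for q i
      using that by (auto simp: coeff_scalar_mult)
    moreover have "hits d (int q) \<and> int i + int q = d * int D" if "coeff (coeff y q) i \<noteq> 0" for q i
      using that e hits_nonneg[OF e(1)] hits_le[OF e(1)] by (auto simp: coeff_st_monom split: if_splits)
    ultimately show ?case using step(2) by meson
  qed simp
  then show ?thesis using assms(2) by blast
qed

lemma component_mult_monom:
  fixes x :: "'k::field poly poly"
  assumes "x \<in> component d" "hits d' e'" "int a + e' = d' * int D" "int b = e'"
  shows "x * st_monom a b \<in> component (d + d')"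
proof -
  interpret module "scalar_mult :: 'k \<Rightarrow> 'k poly poly \<Rightarrow> 'k poly poly" by (rule module_scalar_mult)
  show ?thesis using assms(1) unfolding component_eq_span[of d]
  proof (induction rule: span_induct_alt)
    case base
    then show ?case by (simp add: component_eq_span span_zero)
  next
    case (step c y z)
    from step(1) obtain e where e: "hits d e" "y = st_monom (nat (d * int D - e)) (nat e)"
      by (auto simp: monoms_def)
    have "y * st_monom a b = st_monom (nat ((d + d') * int D - (e + e'))) (nat (e + e'))"
    proof -
      have "int (nat (d * int D - e) + a) = (d + d') * int D - (e + e')"
        using hits_le[OF e(1)] assms(3) by (simp add: algebra_simps)
      then have "nat (d * int D - e) + a = nat ((d + d') * int D - (e + e'))" by linarith
      moreover have "nat e + b = nat (e + e')" using assms(4) hits_nonneg[OF e(1)] by linarith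
      ultimately show ?thesis by (simp add: e(2) st_monom_mult)
    qed
    then have "y * st_monom a b \<in> monoms (d + d')"
      using hits_add[OF e(1) assms(2)] by (auto simp: monoms_def)
    then have "y * st_monom a b \<in> component (d + d')" by (simp add: component_eq_span span_base)
    then show ?case using step(2)
      by (simp add: distrib_right scalar_mult_mult component_eq_span span_add span_scale)
  qed
qed

end

section \<open>Localizations at products of generators\<close>

context projective_monomial_curve
begin

text \<open>
  The element \<open>c s\<^bsup>j D - e\<^esup> t\<^sup>e\<close> of the fraction field: positive exponents go to the numerator, negative
  ones to the denominator.
\<close>
definition laurent_monom :: "'k::field \<Rightarrow> int \<Rightarrow> int \<Rightarrow> 'k poly poly fract" where
  "laurent_monom c j e = Fract (scalar_mult c (st_monom (nat (j * int D - e)) (nat e)))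
     (st_monom (nat (e - j * int D)) (nat (- e)))"

lemma laurent_monom_eq:
  assumes "int a - int a' = j * int D - e" "int b - int b' = e"
  shows "Fract (scalar_mult c (st_monom a b)) (st_monom a' b') = laurent_monom c j e"
proof -
  have "a + nat (e - j * int D) = nat (j * int D - e) + a'" "b + nat (- e) = nat e + b'"
    using assms by linarith+
  then show ?thesis
    by (simp add: laurent_monom_def eq_fract scalar_mult_mult st_monom_mult)
qed

text \<open>
  Degree \<open>j\<close> part of the localization at the monomial of the point \<open>(m, p)\<close>; \<open>loc_hits\<close> describes its
  monomials. Products of generators have this form, and only \<open>m\<close> and \<open>p\<close> matter. The values
  \<open>m = p = 0\<close> give the ring itself.
\<close>
definition loc :: "nat \<Rightarrow> nat \<Rightarrow> int \<Rightarrow> 'k::field poly poly fract set" where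
  "loc m p j = localization_component component (st_monom (m * D - p) p) m j"

definition loc_hits :: "nat \<Rightarrow> nat \<Rightarrow> int \<Rightarrow> int \<Rightarrow> bool" where
  "loc_hits m p j e \<longleftrightarrow> (\<exists>k. hits (j + int k * int m) (e + int k * int p))"

lemma in_loc_iff:
  "w \<in> loc m p j \<longleftrightarrow>
    (\<exists>x k. w = Fract x (st_monom (k * (m * D - p)) (k * p)) \<and> x \<in> component (j + int k * int m))"
  by (auto simp: loc_def localization_component_def st_monom_power)

lemma hits_le_nat: "hits (int m) (int p) \<Longrightarrow> p \<le> m * D"
  using hits_le[of "int m" "int p"] by (simp flip: of_nat_mult)

lemma hits_power: "hits (int m) (int p) \<Longrightarrow> hits (int k * int m) (int k * int p)"
proof (induction k)
  case 0
  show ?case using generator_zero by (simp add: generator_def)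
next
  case (Suc k)
  then show ?case using hits_add[of "int m" "int p" "int k * int m" "int k * int p"]
    by (simp add: algebra_simps)
qed

lemma component_subspace:
  fixes x y :: "'k::field poly poly"
  shows "(0 :: 'k poly poly) \<in> component d"
    "x \<in> component d \<Longrightarrow> y \<in> component d \<Longrightarrow> x - y \<in> component d"
    "hits d e \<Longrightarrow> int a + e = d * int D \<Longrightarrow> int b = e \<Longrightarrow> scalar_mult (c :: 'k) (st_monom a b) \<in> component d"
proof -
  interpret module "scalar_mult :: 'k \<Rightarrow> 'k poly poly \<Rightarrow> 'k poly poly" by (rule module_scalar_mult)
  show "(0 :: 'k poly poly) \<in> component d" "x \<in> component d \<Longrightarrow> y \<in> component d \<Longrightarrow> x - y \<in> component d"
    by (simp_all add: component_eq_span span_zero span_diff)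
  assume "hits d e" "int a + e = d * int D" "int b = e"
  then have "st_monom a b = st_monom (nat (d * int D - e)) (nat e)" by (intro arg_cong2[of _ _ _ _ st_monom]) linarith+
  then have "(st_monom a b :: 'k poly poly) \<in> monoms d" using \<open>hits d e\<close> by (auto simp: monoms_def)
  then show "scalar_mult c (st_monom a b) \<in> component d"
    by (simp add: component_eq_span span_scale span_base)
qed

lemma zero_in_loc: "0 \<in> loc m p j"
  unfolding in_loc_iff
  by (intro exI[of _ 0] exI[of _ "0::nat"]) (simp add: component_subspace fract_collapse st_monom_0)

lemma diff_in_loc:
  assumes "hits (int m) (int p)" "v \<in> loc m p j" "w \<in> loc m p j"
  shows "v - w \<in> loc m p j"
proof -
  let ?a = "m * D - p"
  obtain x k where x: "v = Fract x (st_monom (k * ?a) (k * p))" "x \<in> component (j + int k * int m)"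
    using assms(2) by (auto simp: in_loc_iff)
  obtain y l where y: "w = Fract y (st_monom (l * ?a) (l * p))" "y \<in> component (j + int l * int m)"
    using assms(3) by (auto simp: in_loc_iff)
  have shift: "z * st_monom (l * ?a) (l * p) \<in> component (d + int l * int m)"
    if "z \<in> component d" for z d l
  proof (rule component_mult_monom[OF that hits_power[OF assms(1)]])
    show "int (l * ?a) + int l * int p = int l * int m * int D"
      using hits_le_nat[OF assms(1)] by (simp add: of_nat_diff algebra_simps)
  qed simp
  have "v - w = Fract (x * st_monom (l * ?a) (l * p) - y * st_monom (k * ?a) (k * p))
      (st_monom ((k + l) * ?a) ((k + l) * p))"
    by (simp add: x y st_monom_mult add_mult_distrib)
  moreover have "x * st_monom (l * ?a) (l * p) - y * st_monom (k * ?a) (k * p)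
      \<in> component (j + int (k + l) * int m)"
    using shift[OF x(2), of l] shift[OF y(2), of k]
    by (intro component_subspace) (simp_all add: algebra_simps)
  ultimately show ?thesis unfolding in_loc_iff by blast
qed

lemma add_in_loc:
  assumes "hits (int m) (int p)" "v \<in> loc m p j" "w \<in> loc m p j"
  shows "v + w \<in> loc m p j"
  using diff_in_loc[OF assms(1,2) diff_in_loc[OF assms(1) zero_in_loc assms(3)]] by simp

lemma laurent_monom_in_loc:
  assumes "hits (int m) (int p)" "loc_hits m p j e"
  shows "laurent_monom c j e \<in> loc m p j"
proof -
  obtain k where k: "hits (j + int k * int m) (e + int k * int p)" using assms(2) by (auto simp: loc_hits_def)
  define a where "a = nat ((j + int k * int m) * int D - (e + int k * int p))"
  define b where "b = nat (e + int k * int p)"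
  have ab: "int a + (e + int k * int p) = (j + int k * int m) * int D" "int b = e + int k * int p"
    using hits_le[OF k] hits_nonneg[OF k] by (simp_all add: a_def b_def)
  have "laurent_monom c j e = Fract (scalar_mult c (st_monom a b)) (st_monom (k * (m * D - p)) (k * p))"
    using hits_le_nat[OF assms(1)] ab
    by (intro laurent_monom_eq[symmetric]) (simp_all add: of_nat_diff algebra_simps)
  then show ?thesis unfolding in_loc_iff using component_subspace(3)[OF k ab] by blast
qed

text \<open>
  An element of the fraction field that is a polynomial over a monomial is a sum of Laurent monomials;
  a property that is inherited by adding one of them can be proved by induction. The support
  condition \<open>T\<close> is a parameter so that the same induction serves a single localization and an
  intersection of two.
\<close>
lemma fract_induct_support:
  fixes x :: "'k::field poly poly"
  assumes support: "\<And>i q. coeff (coeff x q) i \<noteq> 0 \<Longrightarrow>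
      int i + int q = (j + int k * int m) * int D \<and> T (int q - int k * int p)"
    and p: "p \<le> m * D"
    and zero: "P 0" and add: "\<And>w c e. P w \<Longrightarrow> T e \<Longrightarrow> P (laurent_monom c j e + w)"
  shows "P (Fract x (st_monom (k * (m * D - p)) (k * p)))"
proof -
  interpret module "scalar_mult :: 'k \<Rightarrow> 'k poly poly \<Rightarrow> 'k poly poly" by (rule module_scalar_mult)
  let ?B = "{st_monom i q | i q. int i + int q = (j + int k * int m) * int D \<and> T (int q - int k * int p)}"
  let ?f = "st_monom (k * (m * D - p)) (k * p) :: 'k poly poly"
  have "x \<in> span ?B" using support by (intro in_span_of_support) blast
  then show ?thesis
  proof (induction rule: span_induct_alt)
    case base
    then show ?case using zero by (simp add: fract_collapse)
  next
    case (step c y z)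
    then obtain i q where iq: "y = st_monom i q" "int i + int q = (j + int k * int m) * int D"
      "T (int q - int k * int p)" by blast
    have "Fract (scalar_mult c y) ?f = laurent_monom c j (int q - int k * int p)"
      unfolding iq(1) using p iq(2) by (intro laurent_monom_eq) (simp_all add: of_nat_diff algebra_simps)
    moreover have "Fract (scalar_mult c y + z) ?f = Fract (scalar_mult c y) ?f + Fract z ?f"
      by (simp add: eq_fract algebra_simps)
    ultimately show ?case using add[OF step(2) iq(3)] by simp
  qed
qed

lemma loc_induct:
  assumes "w \<in> loc m p j" and p: "hits (int m) (int p)"
    and "P 0" "\<And>w c e. P w \<Longrightarrow> loc_hits m p j e \<Longrightarrow> P (laurent_monom c j e + w)"
  shows "P w"
proof -
  obtain x k where x: "w = Fract x (st_monom (k * (m * D - p)) (k * p))" "x \<in> component (j + int k * int m)"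
    using assms(1) by (auto simp: in_loc_iff)
  show ?thesis unfolding x(1)
  proof (rule fract_induct_support[where T = "loc_hits m p j"])
    fix i q assume "coeff (coeff x q) i \<noteq> 0"
    then have "hits (j + int k * int m) (int q) \<and> int i + int q = (j + int k * int m) * int D"
      by (rule component_support[OF x(2)])
    then show "int i + int q = (j + int k * int m) * int D \<and> loc_hits m p j (int q - int k * int p)"
      by (auto simp: loc_hits_def intro!: exI[of _ k])
  qed (use assms hits_le_nat in auto)
qed

lemma loc_subset:
  assumes "hits (int m) (int p)" "hits (int m') (int p')"
    and "\<And>e. loc_hits m p j e \<Longrightarrow> loc_hits m' p' j e"
  shows "loc m p j \<subseteq> loc m' p' j"
proof
  fix w assume "w \<in> loc m p j"
  from this assms(1) show "w \<in> loc m' p' j"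
    by (rule loc_induct) (simp_all add: zero_in_loc add_in_loc laurent_monom_in_loc assms)
qed

text \<open>
  The support of an element is independent of the fraction that represents it, hence satisfies the
  conditions of both localizations.
\<close>
lemma loc_Int_subset:
  assumes "hits (int m) (int p)" "hits (int m') (int p')" "hits (int m'') (int p'')"
    and sub: "\<And>e. loc_hits m p j e \<Longrightarrow> loc_hits m' p' j e \<Longrightarrow> loc_hits m'' p'' j e"
  shows "loc m p j \<inter> loc m' p' j \<subseteq> loc m'' p'' j"
proof
  fix w assume w: "w \<in> loc m p j \<inter> loc m' p' j"
  let ?u = "m * D - p" and ?u' = "m' * D - p'"
  obtain x k where x: "w = Fract x (st_monom (k * ?u) (k * p))" "x \<in> component (j + int k * int m)"
    using w by (auto simp: in_loc_iff)
  obtain y l where y: "w = Fract y (st_monom (l * ?u') (l * p'))" "y \<in> component (j + int l * int m')"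
    using w by (auto simp: in_loc_iff)
  have "x * st_monom (l * ?u') (l * p') = y * st_monom (k * ?u) (k * p)"
    using x(1) y(1) by (simp add: eq_fract)
  then have eq: "st_monom (l * ?u') (l * p') * x = st_monom (k * ?u) (k * p) * y"
    by (simp add: mult.commute)
  show "w \<in> loc m'' p'' j" unfolding x(1)
  proof (rule fract_induct_support[where T = "\<lambda>e. loc_hits m p j e \<and> loc_hits m' p' j e"])
    fix i q assume nz: "coeff (coeff x q) i \<noteq> 0"
    have h: "hits (j + int k * int m) (int q)" "int i + int q = (j + int k * int m) * int D"
      using component_support[OF x(2) nz] by auto
    have "coeff (coeff (st_monom (k * ?u) (k * p) * y) (q + l * p')) (i + l * ?u') \<noteq> 0"
      using nz by (simp flip: eq add: coeff_st_monom_mult)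
    then have "k * p \<le> q + l * p'" "coeff (coeff y (q + l * p' - k * p)) (i + l * ?u' - k * ?u) \<noteq> 0"
      by (auto simp: coeff_st_monom_mult split: if_splits)
    then have "hits (j + int l * int m') (int q - int k * int p + int l * int p')"
      using component_support[OF y(2)] by (force simp: of_nat_diff algebra_simps)
    then show "int i + int q = (j + int k * int m) * int D \<and>
        loc_hits m p j (int q - int k * int p) \<and> loc_hits m' p' j (int q - int k * int p)"
      using h unfolding loc_hits_def
      by (intro conjI exI[of _ k] exI[of _ l]) simp_all
  qed (use assms hits_le_nat in \<open>auto simp: zero_in_loc intro!: add_in_loc laurent_monom_in_loc\<close>)
qed

lemma laurent_monom_in_loc_sum:
  fixes v w :: "'k::field poly poly fract"
  assumes eq: "laurent_monom 1 j e = v + w" and v: "v \<in> loc m p j" and w: "w \<in> loc m' p' j"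
  shows "loc_hits m p j e \<or> loc_hits m' p' j e"
proof -
  define a b a' b' where ab: "a = nat (j * int D - e)" "b = nat e" "a' = nat (e - j * int D)" "b' = nat (- e)"
  have bb: "int b - int b' = e" by (simp add: ab)
  have support: "loc_hits m p j e"
    if "x \<in> component (j + int k * int m)" "b' \<le> b + k * p"
      "coeff (coeff x (b + k * p - b')) i \<noteq> 0" for x :: "'k poly poly" and k m p i
  proof -
    have "hits (j + int k * int m) (int (b + k * p - b'))" using component_support[OF that(1,3)] ..
    moreover have "int (b + k * p - b') = e + int k * int p"
      using that(2) bb by (simp add: of_nat_diff)
    ultimately show ?thesis by (auto simp: loc_hits_def)
  qed
  obtain x k where x: "v = Fract x (st_monom (k * (m * D - p)) (k * p))" "x \<in> component (j + int k * int m)"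
    using v by (auto simp: in_loc_iff)
  obtain y l where y: "w = Fract y (st_monom (l * (m' * D - p')) (l * p'))" "y \<in> component (j + int l * int m')"
    using w by (auto simp: in_loc_iff)
  have "Fract (st_monom a b) (st_monom a' b') =
      Fract x (st_monom (k * (m * D - p)) (k * p)) + Fract y (st_monom (l * (m' * D - p')) (l * p'))"
    using eq by (simp only: x(1) y(1) laurent_monom_def ab scalar_mult_one)
  from monom_eq_sum_of_fractions[OF this] show ?thesis
    by (elim disjE conjE) (rule disjI1, erule (1) support[OF x(2)], rule disjI2, erule (1) support[OF y(2)])
qed

lemma hits_ends: "hits 0 0" "hits 1 0" "hits 1 (int D)"
  using generator_zero hits_mult[OF zero_in_E, of 1] hits_mult[OF D_in_E, of 1]
  by (simp_all add: generator_def)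

lemma hits_sum: "S \<subseteq> {..<length es} \<Longrightarrow> hits (int (card S)) (int (\<Sum>k\<in>S. es ! k))"
proof (induction S rule: infinite_finite_induct)
  case (infinite S)
  then show ?case by (meson finite_lessThan finite_subset)
next
  case empty
  show ?case using hits_ends(1) by simp
next
  case (insert k S)
  then have "es ! k \<in> set es" by simp
  then have "hits 1 (int (es ! k))" using hits_mult[of "es ! k" 1] by simp
  moreover have "hits (int (card S)) (int (\<Sum>k\<in>S. es ! k))" using insert by simp
  ultimately have "hits (1 + int (card S)) (int (es ! k) + int (\<Sum>k\<in>S. es ! k))" by (rule hits_add)
  then show ?case using insert.hyps by simp
qed

lemma prod_gens:
  "S \<subseteq> {..<length es} \<Longrightarrow>
    (\<Prod>k\<in>S. gens ! k) = (st_monom (card S * D - (\<Sum>k\<in>S. es ! k)) (\<Sum>k\<in>S. es ! k) :: 'k::field poly poly)"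
proof (induction S rule: infinite_finite_induct)
  case (infinite S)
  then show ?case by (meson finite_lessThan finite_subset)
next
  case empty
  show ?case by (simp add: st_monom_0)
next
  case (insert k S)
  then have k: "k < length es" "S \<subseteq> {..<length es}" by auto
  have g: "gens ! k = (st_monom (D - es ! k) (es ! k) :: 'k poly poly)"
    using k(1) by (simp add: gens_def)
  have "(\<Prod>k\<in>insert k S. gens ! k) = (gens ! k :: 'k poly poly) * (\<Prod>k\<in>S. gens ! k)"
    using insert.hyps by simp
  also have "\<dots> = st_monom (D - es ! k) (es ! k) *
      st_monom (card S * D - (\<Sum>k\<in>S. es ! k)) (\<Sum>k\<in>S. es ! k)"
    by (simp only: insert.IH[OF k(2)] g)
  also have "\<dots> = st_monom (card (insert k S) * D - (\<Sum>k\<in>insert k S. es ! k)) (\<Sum>k\<in>insert k S. es ! k)"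
    using es_le[OF k(1)] hits_le_nat[OF hits_sum[OF k(2)]] insert.hyps
    by (simp only: st_monom_mult card_insert_disjoint sum.insert mult_Suc) simp
  finally show ?case .
qed

lemma loc_hits_interior:
  "0 < p \<Longrightarrow> p < m * D \<Longrightarrow> loc_hits m p j e"
  unfolding loc_hits_def
  by (rule eventually_hits_interior) (simp_all flip: of_nat_mult)

lemma loc_hits_ends:
  "loc_hits 0 0 j e \<longleftrightarrow> hits j e" "loc_hits 1 0 j e \<longleftrightarrow> s_hits j e" "loc_hits 1 D j e \<longleftrightarrow> t_hits j e"
  by (simp_all add: loc_hits_def s_hits_def t_hits_def)

end

section \<open>Local cohomology, reduction number and regularity\<close>

context projective_monomial_curve
begin

definition last_index :: nat where "last_index = length es - 1"

definition set_loc :: "int \<Rightarrow> nat set \<Rightarrow> 'k::field poly poly fract set" where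
  "set_loc j S = localization_component component (\<Prod>k\<in>S. gens ! k) (card S) j"

lemma set_loc_eq: "S \<subseteq> {..last_index} \<Longrightarrow> set_loc j S = loc (card S) (\<Sum>k\<in>S. es ! k) j"
proof -
  assume "S \<subseteq> {..last_index}"
  moreover have "{..last_index} \<subseteq> {..<length es}" using length_es by (auto simp: last_index_def)
  ultimately have "S \<subseteq> {..<length es}" by (rule subset_trans)
  then show ?thesis by (simp only: set_loc_def loc_def prod_gens)
qed

lemma hits_index_sum: "S \<subseteq> {..last_index} \<Longrightarrow> hits (int (card S)) (int (\<Sum>k\<in>S. es ! k))"
  using length_es by (intro hits_sum) (auto simp: last_index_def)

text \<open>
  A product of generators lies on a boundary ray only if it is empty or one of the two end generators,
  since an index set that is not contained in \<open>{0}\<close> has a positive exponent, and one that is not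
  contained in \<open>{last_index}\<close> has an exponent below \<open>D\<close>.
\<close>
lemma interior_index_sum:
  assumes S: "S \<subseteq> {..last_index}" "S \<notin> {{}, {0}, {last_index}}"
  shows "0 < (\<Sum>k\<in>S. es ! k)" "(\<Sum>k\<in>S. es ! k) < card S * D"
proof -
  have fin: "finite S" using S(1) finite_subset by blast
  have pos: "0 < es ! k" if "k \<noteq> 0" "k \<in> S" for k
    using that S(1) interior[of k] last D_positive
    by (cases "k = last_index") (auto simp: last_index_def subset_iff)
  have less: "es ! k < D" if "k \<noteq> last_index" "k \<in> S" for k
    using that S(1) interior[of k] first D_positive
    by (cases "k = 0") (auto simp: last_index_def subset_iff)
  have "\<not> S \<subseteq> {0}" "\<not> S \<subseteq> {last_index}" using S(2) by (auto simp: subset_singleton_iff)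
  then obtain k l where k: "k \<in> S" "k \<noteq> 0" and l: "l \<in> S" "l \<noteq> last_index" by blast
  then have "es ! k \<le> (\<Sum>k\<in>S. es ! k)" using fin by (intro member_le_sum) auto
  then show "0 < (\<Sum>k\<in>S. es ! k)" using pos[OF k(2,1)] by linarith
  have le: "es ! k \<le> D" if "k \<in> S" for k
    using that S(1) length_es by (intro es_le) (auto simp: last_index_def subset_iff)
  have "(\<Sum>k\<in>S. es ! k) < (\<Sum>k\<in>S. D)"
    by (rule sum_strict_mono_ex1[OF fin]) (use l less le in blast)+
  then show "(\<Sum>k\<in>S. es ! k) < card S * D" by simp
qed

text \<open>
  Enlarging the index set enlarges the localization, as further multiplication by elements of the ring
  is harmless; between the boundary rays every point is reached.
\<close>
lemma two_ended_cech:
  "two_ended_cech component (gens :: 'k::field poly poly list) j (set_loc j) last_index"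
proof
  let ?N = last_index
  have hits: "hits (int (card S)) (int (\<Sum>k\<in>S. es ! k))" if "S \<subseteq> {..?N}" for S
    using that by (rule hits_index_sum)
  show "length (gens :: 'k poly poly list) = Suc ?N" "2 \<le> ?N"
    using length_es by (simp_all add: gens_def last_index_def)
  show "(0 :: 'k poly poly fract) \<in> set_loc j S" if "S \<subseteq> {..?N}" for S
    by (simp add: set_loc_eq[OF that] zero_in_loc)
  show "x - y \<in> set_loc j S" if "S \<subseteq> {..?N}" "x \<in> set_loc j S" "y \<in> set_loc j S"
    for S and x y :: "'k poly poly fract"
    using that(2,3) diff_in_loc[OF hits[OF that(1)]] by (simp add: set_loc_eq[OF that(1)])
  show "(set_loc j S :: 'k poly poly fract set) \<subseteq> set_loc j T" if "S \<subseteq> T" "T \<subseteq> {..?N}" for S T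
  proof -
    have S: "S \<subseteq> {..?N}" using that by (rule subset_trans)
    have "T - S \<subseteq> {..?N}" using that(2) by blast
    note d = hits[OF this]
    have fin: "finite T" using that(2) finite_subset by blast
    have sums: "(\<Sum>k\<in>T. es ! k) = (\<Sum>k\<in>S. es ! k) + (\<Sum>k\<in>T - S. es ! k)"
      "card T = card S + card (T - S)"
      using fin that(1) finite_subset[OF that(1) fin]
      by (simp_all add: sum.subset_diff card_Diff_subset card_mono add.commute)
    have "loc_hits (card T) (\<Sum>k\<in>T. es ! k) j e" if h: "loc_hits (card S) (\<Sum>k\<in>S. es ! k) j e" for e
    proof -
      obtain k where "hits (j + int k * int (card S)) (e + int k * int (\<Sum>k\<in>S. es ! k))"
        using h by (auto simp: loc_hits_def)
      from hits_add[OF this hits_power[OF d, of k]]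
      have "hits (j + int k * int (card T)) (e + int k * int (\<Sum>k\<in>T. es ! k))"
        by (simp only: sums of_nat_add distrib_left add.assoc)
      then show ?thesis by (auto simp: loc_hits_def)
    qed
    then show ?thesis
      unfolding set_loc_eq[OF S] set_loc_eq[OF that(2)]
      by (intro loc_subset hits S that(2))
  qed
  show "set_loc j S = (set_loc j {0, ?N} :: 'k poly poly fract set)"
    if S: "S \<subseteq> {..?N}" "S \<notin> {{}, {0}, {?N}}" for S
  proof -
    have N: "{0, ?N} \<subseteq> {..?N}" "{0, ?N} \<notin> {{}, {0}, {?N}}"
      using length_es by (auto simp: last_index_def)
    show ?thesis
      unfolding set_loc_eq[OF S(1)] set_loc_eq[OF N(1)]
      by (intro subset_antisym loc_subset hits loc_hits_interior interior_index_sum S N)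
  qed
qed (simp add: set_loc_def)

lemma set_loc_ends:
  "set_loc j {} = loc 0 0 j" "set_loc j {0} = loc 1 0 j" "set_loc j {last_index} = loc 1 D j"
  "set_loc j {0, last_index} = loc 2 D j"
proof -
  have "last_index \<noteq> 0" "es ! 0 = 0" "es ! last_index = D"
    using length_es first last by (simp_all add: last_index_def)
  then show "set_loc j {} = loc 0 0 j" "set_loc j {0} = loc 1 0 j"
    "set_loc j {last_index} = loc 1 D j" "set_loc j {0, last_index} = loc 2 D j"
    by (simp_all add: set_loc_eq numeral_2_eq_2)
qed

text \<open>
  The criteria for \<open>H\<^sup>1\<close> and \<open>H\<^sup>2\<close> are statements about subspaces spanned by Laurent monomials, so they
  can be tested on the single points \<open>(j, e)\<close>.
\<close>
lemma regularity_degrees_eq: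
  "regularity_degrees component (gens :: 'k::field poly poly list) =
    {j + 1 | j. \<exists>e. s_hits j e \<and> t_hits j e \<and> \<not> hits j e} \<union>
    {j + 2 | j. \<exists>e. \<not> s_hits j e \<and> \<not> t_hits j e}"
proof -
  have hits: "hits (int 0) (int 0)" "hits (int 1) (int 0)" "hits (int 1) (int D)" "hits (int 2) (int D)"
    using hits_ends hits_add[OF hits_ends(2,3)] by simp_all
  let ?nz = "local_cohomology_nonzero component (gens :: 'k poly poly list)"
  have 1: "?nz 1 j \<longleftrightarrow> (\<exists>e. s_hits j e \<and> t_hits j e \<and> \<not> hits j e)" for j
  proof -
    interpret two_ended_cech component "gens :: 'k poly poly list" j "set_loc j" last_index
      by (rule two_ended_cech)
    have "(loc 1 0 j \<inter> loc 1 D j :: 'k poly poly fract set) \<subseteq> loc 0 0 j \<longleftrightarrow>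
        (\<forall>e. s_hits j e \<longrightarrow> t_hits j e \<longrightarrow> hits j e)"
    proof
      assume sub: "(loc 1 0 j \<inter> loc 1 D j :: 'k poly poly fract set) \<subseteq> loc 0 0 j"
      show "\<forall>e. s_hits j e \<longrightarrow> t_hits j e \<longrightarrow> hits j e"
      proof (intro allI impI)
        fix e assume "s_hits j e" "t_hits j e"
        then have "loc_hits 1 0 j e" "loc_hits 1 D j e" by (simp_all only: loc_hits_ends)
        then have "laurent_monom (1 :: 'k) j e \<in> loc 1 0 j \<inter> loc 1 D j"
          by (intro IntI laurent_monom_in_loc hits)
        then have "laurent_monom (1 :: 'k) j e \<in> loc 0 0 j" using sub by blast
        from laurent_monom_in_loc_sum[OF _ this zero_in_loc[of 0 0]] have "loc_hits 0 0 j e" by simp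
        then show "hits j e" by (simp only: loc_hits_ends)
      qed
    next
      assume "\<forall>e. s_hits j e \<longrightarrow> t_hits j e \<longrightarrow> hits j e"
      then show "(loc 1 0 j \<inter> loc 1 D j :: 'k poly poly fract set) \<subseteq> loc 0 0 j"
        by (intro loc_Int_subset hits) (simp only: loc_hits_ends)
    qed
    then show ?thesis unfolding local_cohomology_1 set_loc_ends by blast
  qed
  have 2: "?nz 2 j \<longleftrightarrow> (\<exists>e. \<not> s_hits j e \<and> \<not> t_hits j e)" for j
  proof -
    interpret two_ended_cech component "gens :: 'k poly poly list" j "set_loc j" last_index
      by (rule two_ended_cech)
    have "loc 2 D j \<subseteq> {u + v | u v :: 'k poly poly fract. u \<in> loc 1 0 j \<and> v \<in> loc 1 D j} \<longleftrightarrow>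
        (\<forall>e. s_hits j e \<or> t_hits j e)" (is "_ \<subseteq> ?sums \<longleftrightarrow> _")
    proof
      assume sub: "loc 2 D j \<subseteq> ?sums"
      show "\<forall>e. s_hits j e \<or> t_hits j e"
      proof
        fix e
        have "laurent_monom (1 :: 'k) j e \<in> loc 2 D j"
          by (intro laurent_monom_in_loc hits loc_hits_interior) (simp_all add: D_positive)
        then have "laurent_monom (1 :: 'k) j e \<in> ?sums" using sub by (rule rev_subsetD)
        then obtain u v :: "'k poly poly fract" where
          "laurent_monom 1 j e = u + v" "u \<in> loc 1 0 j" "v \<in> loc 1 D j"
          unfolding mem_Collect_eq by (elim exE conjE)
        then have "loc_hits 1 0 j e \<or> loc_hits 1 D j e" by (rule laurent_monom_in_loc_sum)
        then show "s_hits j e \<or> t_hits j e" by (simp only: loc_hits_ends)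
      qed
    next
      assume all: "\<forall>e. s_hits j e \<or> t_hits j e"
      show "loc 2 D j \<subseteq> ?sums"
      proof
        fix w :: "'k poly poly fract"
        assume "w \<in> loc 2 D j"
        from this hits(4) show "w \<in> ?sums"
        proof (rule loc_induct)
          have "(0 :: 'k poly poly fract) = 0 + 0" by simp
          then show "0 \<in> ?sums" using zero_in_loc by blast
        next
          fix w :: "'k poly poly fract" and c e
          assume "w \<in> ?sums"
          then obtain u v where uv: "w = u + v" "u \<in> loc 1 0 j" "v \<in> loc 1 D j" by blast
          have "s_hits j e \<or> t_hits j e" using all by blast
          then show "laurent_monom c j e + w \<in> ?sums"
          proof
            assume "s_hits j e"
            then have "laurent_monom c j e + u \<in> loc 1 0 j"
              by (intro add_in_loc laurent_monom_in_loc hits uv) (simp only: loc_hits_ends)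
            moreover have "laurent_monom c j e + w = (laurent_monom c j e + u) + v" by (simp add: uv(1) add.assoc)
            ultimately show ?thesis using uv(3) by blast
          next
            assume "t_hits j e"
            then have "laurent_monom c j e + v \<in> loc 1 D j"
              by (intro add_in_loc laurent_monom_in_loc hits uv) (simp only: loc_hits_ends)
            moreover have "laurent_monom c j e + w = u + (laurent_monom c j e + v)" by (simp add: uv(1) add.left_commute)
            ultimately show ?thesis using uv(2) by blast
          qed
        qed
      qed
    qed
    then show ?thesis unfolding local_cohomology_2 set_loc_ends by simp
  qed
  have "i = 1 \<or> i = 2" if "?nz i j" for i j
  proof -
    interpret two_ended_cech component "gens :: 'k poly poly list" j "set_loc j" last_index
      by (rule two_ended_cech)
    have "i \<noteq> 0" "\<not> 3 \<le> i" using that local_cohomology_0 local_cohomology_ge_3 by metis+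
    then show ?thesis by linarith
  qed
  then have "regularity_degrees component (gens :: 'k poly poly list) =
      {int 1 + j | j. ?nz 1 j} \<union> {int 2 + j | j. ?nz 2 j}"
    unfolding regularity_degrees_def by blast
  then show ?thesis by (simp only: 1 2 of_nat_1 of_nat_numeral add.commute)
qed

lemma curve_ring_support:
  assumes "x \<in> curve_ring" "coeff (coeff x q) i \<noteq> 0"
  shows "\<exists>d. hits d (int q) \<and> int i + int q = d * int D"
proof -
  have "\<forall>q i. coeff (coeff x q) i \<noteq> 0 \<longrightarrow> (\<exists>d. hits d (int q) \<and> int i + int q = d * int D)"
    using assms(1) unfolding curve_ring_def
  proof (induction rule: generated_subalgebra.induct)
    case one
    show ?case using hits_ends(1) by (auto simp flip: st_monom_0 simp: coeff_st_monom)
  next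
    case (gen x)
    then obtain a where a: "a \<in> set es" "x = st_monom (D - a) a" by (auto simp: gens_def)
    have "hits 1 (int a)" using hits_mult[OF a(1), of 1] by simp
    then show ?case using E_le[OF a(1)]
      by (auto simp: a(2) coeff_st_monom split: if_splits intro!: exI[of _ 1])
  next
    case (scale x c)
    then show ?case by (simp add: coeff_scalar_mult)
  next
    case (add x y)
    have "coeff (coeff x q) i \<noteq> 0 \<or> coeff (coeff y q) i \<noteq> 0" if "coeff (coeff (x + y) q) i \<noteq> 0" for q i
      using that by auto
    then show ?case using add.IH by meson
  next
    case (mult x y)
    show ?case
    proof (intro allI impI)
      fix q i assume "coeff (coeff (x * y) q) i \<noteq> 0"
      then have "(\<Sum>q'\<le>q. \<Sum>i'\<le>i. coeff (coeff x q') i' * coeff (coeff y (q - q')) (i - i')) \<noteq> 0"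
        by (simp add: coeff_mult coeff_sum)
      then obtain q' where q': "q' \<le> q"
        "(\<Sum>i'\<le>i. coeff (coeff x q') i' * coeff (coeff y (q - q')) (i - i')) \<noteq> 0"
        by (rule sum.not_neutral_contains_not_neutral) simp
      from q'(2) obtain i' where i': "i' \<le> i" "coeff (coeff x q') i' * coeff (coeff y (q - q')) (i - i') \<noteq> 0"
        by (rule sum.not_neutral_contains_not_neutral) simp
      then have nz: "coeff (coeff x q') i' \<noteq> 0" "coeff (coeff y (q - q')) (i - i') \<noteq> 0" by auto
      obtain d where d: "hits d (int q')" "int i' + int q' = d * int D" using mult.IH(1) nz(1) by blast
      obtain d' where d': "hits d' (int (q - q'))" "int (i - i') + int (q - q') = d' * int D"
        using mult.IH(2) nz(2) by blast
      have "hits (d + d') (int q)" using hits_add[OF d(1) d'(1)] q'(1) by (simp add: of_nat_diff)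
      moreover have "int i + int q = (d + d') * int D"
        using d(2) d'(2) q'(1) i'(1) by (simp add: of_nat_diff algebra_simps)
      ultimately show "\<exists>d. hits d (int q) \<and> int i + int q = d * int D" by blast
    qed
  qed
  then show ?thesis using assms(2) by blast
qed

lemma monoms_in_curve_ring:
  assumes "hits d e"
  shows "(st_monom (nat (d * int D - e)) (nat e) :: 'k::field poly poly) \<in> curve_ring"
proof -
  have prods: "prod_list ms \<in> curve_ring" if "set ms \<subseteq> set gens" for ms :: "'k poly poly list"
    using that unfolding curve_ring_def
    by (induction ms) (auto intro: generated_subalgebra.intros)
  have "st_monom (nat (d * int D - e)) (nat e) \<in> (monoms d :: 'k poly poly set)"
    unfolding monoms_def using assms by blast
  then obtain ms :: "'k poly poly list" where
    "set ms \<subseteq> set gens" "st_monom (nat (d * int D - e)) (nat e) = prod_list ms"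
    unfolding products_eq_monoms[symmetric] mem_Collect_eq by (elim exE conjE)
  then show ?thesis using prods by (simp only:)
qed

text \<open>
  If \<open>s\<^sup>i t\<^sup>q = x s\<^sup>D + y t\<^sup>D\<close> with \<open>x\<close>, \<open>y\<close> in the ring, then the monomial divided by \<open>s\<^sup>D\<close> occurs in
  \<open>x\<close> or the monomial divided by \<open>t\<^sup>D\<close> occurs in \<open>y\<close>; comparison of total degrees shows that the
  quotient has degree \<open>m\<close>.
\<close>
lemma component_subset_end_ideal_iff:
  assumes "0 \<le> m"
  shows "(component (m + 1) :: 'k::field poly poly set) \<subseteq> end_ideal \<longleftrightarrow> (\<forall>e. \<not> generator (m + 1) e)"
proof
  assume sub: "(component (m + 1) :: 'k poly poly set) \<subseteq> end_ideal"
  show "\<forall>e. \<not> generator (m + 1) e"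
  proof
    fix e
    show "\<not> generator (m + 1) e"
    proof
      assume g: "generator (m + 1) e"
      then have h: "hits (m + 1) e" "\<not> hits m e" "\<not> hits m (e - int D)" by (simp_all add: generator_def)
      define a b where ab: "a = nat ((m + 1) * int D - e)" "b = nat e"
      have eqs: "int a + int b = (m + 1) * int D" "int b = e"
        using hits_le[OF h(1)] hits_nonneg[OF h(1)] by (simp_all add: ab)
      have "scalar_mult (1 :: 'k) (st_monom a b) \<in> component (m + 1)"
        using eqs by (intro component_subspace(3)[OF h(1)]) simp_all
      then have "(st_monom a b :: 'k poly poly) \<in> end_ideal" using sub by (auto simp: scalar_mult_one)
      then obtain x y :: "'k poly poly" where xy: "x \<in> curve_ring" "y \<in> curve_ring"
        "st_monom a b = x * st_monom D 0 + y * st_monom 0 D" by (auto simp: end_ideal_def)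
      have eq: "st_monom D 0 * x + st_monom 0 D * y = st_monom a b"
        unfolding xy(3) by (simp only: mult.commute)
      have "coeff (coeff (st_monom D 0 * x + st_monom 0 D * y) b) a = (1 :: 'k)"
        unfolding eq by (simp add: coeff_st_monom)
      then have "coeff (coeff (st_monom D 0 * x) b) a \<noteq> 0 \<or> coeff (coeff (st_monom 0 D * y) b) a \<noteq> 0"
        by (metis add_0 coeff_add zero_neq_one)
      then show False
      proof
        assume "coeff (coeff (st_monom D 0 * x) b) a \<noteq> 0"
        then have "D \<le> a" "coeff (coeff x b) (a - D) \<noteq> 0"
          by (simp_all add: coeff_st_monom_mult split: if_splits)
        then obtain d where d: "hits d (int b)" "int (a - D) + int b = d * int D"
          using curve_ring_support[OF xy(1)] by blast
        then have "d * int D = m * int D" using eqs \<open>D \<le> a\<close> by (simp add: of_nat_diff algebra_simps)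
        then have "d = m" using D_positive by simp
        then show False using d h(2) eqs by simp
      next
        assume "coeff (coeff (st_monom 0 D * y) b) a \<noteq> 0"
        then have "D \<le> b" "coeff (coeff y (b - D)) a \<noteq> 0"
          by (simp_all add: coeff_st_monom_mult split: if_splits)
        then obtain d where d: "hits d (int (b - D))" "int a + int (b - D) = d * int D"
          using curve_ring_support[OF xy(2)] by blast
        then have "d * int D = m * int D" using eqs \<open>D \<le> b\<close> by (simp add: of_nat_diff algebra_simps)
        then have "d = m" using D_positive by simp
        then show False using d h(3) eqs \<open>D \<le> b\<close> by (simp add: of_nat_diff)
      qed
    qed
  qed
next
  assume none: "\<forall>e. \<not> generator (m + 1) e"
  interpret module "scalar_mult :: 'k \<Rightarrow> 'k poly poly \<Rightarrow> 'k poly poly" by (rule module_scalar_mult)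
  have zero: "(0 :: 'k poly poly) \<in> curve_ring"
    using generated_subalgebra.scale[OF generated_subalgebra.one, of 0]
    by (simp add: curve_ring_def scalar_mult_def)
  have monom: "y \<in> end_ideal" if "y \<in> monoms (m + 1)" for y :: "'k poly poly"
  proof -
    from that obtain e where e: "hits (m + 1) e" "y = st_monom (nat ((m + 1) * int D - e)) (nat e)"
      by (auto simp: monoms_def)
    consider "hits m e" | "hits m (e - int D)" using e(1) none by (auto simp: generator_def)
    then show ?thesis
    proof cases
      case 1
      have "nat ((m + 1) * int D - e) = nat (m * int D - e) + D"
        using hits_le[OF 1] by (simp add: algebra_simps nat_add_distrib)
      then have "y = st_monom (nat (m * int D - e)) (nat e) * st_monom D 0 + 0 * st_monom 0 D"
        by (simp add: e(2) st_monom_mult)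
      then show ?thesis using monoms_in_curve_ring[OF 1] zero unfolding end_ideal_def by blast
    next
      case 2
      have "nat e = nat (e - int D) + D" using hits_nonneg[OF 2] by linarith
      moreover have "nat ((m + 1) * int D - e) = nat (m * int D - (e - int D))"
        by (simp add: algebra_simps)
      ultimately have "y = 0 * st_monom D 0 + st_monom (nat (m * int D - (e - int D))) (nat (e - int D)) * st_monom 0 D"
        by (simp add: e(2) st_monom_mult)
      then show ?thesis using monoms_in_curve_ring[OF 2] zero unfolding end_ideal_def by blast
    qed
  qed
  show "(component (m + 1) :: 'k poly poly set) \<subseteq> end_ideal"
  proof
    fix x :: "'k poly poly" assume "x \<in> component (m + 1)"
    then show "x \<in> end_ideal" unfolding component_eq_span
    proof (induction rule: span_induct_alt)
      case base
      have "0 = 0 * st_monom D 0 + 0 * (st_monom 0 D :: 'k poly poly)" by simp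
      then show ?case using zero unfolding end_ideal_def by blast
    next
      case (step c y z)
      obtain u v where uv: "u \<in> curve_ring" "v \<in> curve_ring" "y = u * st_monom D 0 + v * st_monom 0 D"
        using monom[OF step(1)] by (auto simp: end_ideal_def)
      obtain u' v' where uv': "u' \<in> curve_ring" "v' \<in> curve_ring" "z = u' * st_monom D 0 + v' * st_monom 0 D"
        using step(2) by (auto simp: end_ideal_def)
      have "scalar_mult c y + z = (scalar_mult c u + u') * st_monom D 0 + (scalar_mult c v + v') * st_monom 0 D"
        by (simp add: uv(3) uv'(3) scale_right_distrib scalar_mult_mult distrib_right algebra_simps)
      moreover have "scalar_mult c u + u' \<in> curve_ring" "scalar_mult c v + v' \<in> curve_ring"
        using uv uv' unfolding curve_ring_def by (auto intro: generated_subalgebra.intros)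
      ultimately show ?case unfolding end_ideal_def by blast
    qed
  qed
qed

text \<open>
  Generators occur in every degree up to \<open>top_degree\<close>, so the first degree without a new generator is
  \<open>top_degree + 1\<close>.
\<close>
lemma reduction_number_eq:
  "int (reduction_number component (end_ideal :: 'k::field poly poly set)) = top_degree \<and>
    (\<exists>m. component (int m + 1) = end_ideal \<inter> (component (int m + 1) :: 'k poly poly set))"
proof -
  have iff: "component (int m + 1) = end_ideal \<inter> (component (int m + 1) :: 'k poly poly set) \<longleftrightarrow>
      top_degree \<le> int m" for m
  proof -
    have "(component (int m + 1) = end_ideal \<inter> (component (int m + 1) :: 'k poly poly set)) \<longleftrightarrow>
        (component (int m + 1) :: 'k poly poly set) \<subseteq> end_ideal" by blast
    also have "\<dots> \<longleftrightarrow> (\<forall>e. \<not> generator (int m + 1) e)" by (rule component_subset_end_ideal_iff) simp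
    also have "\<dots> \<longleftrightarrow> top_degree \<le> int m"
      using generators_in_all_lower_degrees[of "Suc m"] generator_le_top_degree[of "int m + 1"]
      by (force simp: add.commute)
    finally show ?thesis .
  qed
  have "reduction_number component (end_ideal :: 'k poly poly set) = nat top_degree"
    unfolding reduction_number_def iff by (rule Least_equality) linarith+
  then show ?thesis unfolding iff using top_degree_nonneg by (auto intro!: exI[of _ "nat top_degree"])
qed

text \<open>
  The assumption says that \<open>s\<^sup>D t\<^sup>D\<close> maps the intersection of the localizations at \<open>s\<^sup>D\<close> and \<open>t\<^sup>D\<close> into
  the ring, that is, annihilates \<open>H\<^sup>1\<close>. Both invariants are then equal to the largest degree of a
  generator.
\<close>
theorem regularity_eq_reduction_number:
  assumes kill: "\<And>d e. s_hits d e \<Longrightarrow> t_hits d e \<Longrightarrow> hits (d + 2) (e + int D)"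
  shows "(\<exists>m. component (int m + 1) = end_ideal \<inter> (component (int m + 1) :: 'k::field poly poly set)) \<and>
    (\<exists>d\<in>regularity_degrees component (gens :: 'k poly poly list).
      \<forall>d'\<in>regularity_degrees component (gens :: 'k poly poly list). d' \<le> d) \<and>
    regularity component (gens :: 'k poly poly list) =
      int (reduction_number component (end_ideal :: 'k poly poly set))"
proof -
  let ?RD = "regularity_degrees component (gens :: 'k poly poly list)"
  obtain e where "generator top_degree e" using generator_top_degree by blast
  from generator_gives_cohomology[OF this] have mem: "top_degree \<in> ?RD"
    unfolding regularity_degrees_eq
  proof
    assume "\<exists>e. s_hits (top_degree - 1) e \<and> t_hits (top_degree - 1) e \<and> \<not> hits (top_degree - 1) e"
    then show "top_degree \<in> {j + 1 | j. \<exists>e. s_hits j e \<and> t_hits j e \<and> \<not> hits j e} \<union>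
        {j + 2 | j. \<exists>e. \<not> s_hits j e \<and> \<not> t_hits j e}"
      by (intro UnI1 CollectI exI[of _ "top_degree - 1"]) simp
  next
    assume "\<exists>e. \<not> s_hits (top_degree - 2) e \<and> \<not> t_hits (top_degree - 2) e"
    then show "top_degree \<in> {j + 1 | j. \<exists>e. s_hits j e \<and> t_hits j e \<and> \<not> hits j e} \<union>
        {j + 2 | j. \<exists>e. \<not> s_hits j e \<and> \<not> t_hits j e}"
      by (intro UnI2 CollectI exI[of _ "top_degree - 2"]) simp
  qed
  have le: "d \<le> top_degree" if "d \<in> ?RD" for d
    using that H1_degree_le_top_degree[OF kill] H2_degree_le_top_degree unfolding regularity_degrees_eq by blast
  have "regularity component (gens :: 'k poly poly list) = top_degree"
    unfolding regularity_def using mem le by (intro Greatest_equality)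
  then show ?thesis using reduction_number_eq mem le by auto
qed

end

section \<open>The two-parameter family\<close>

definition family_exponents :: "nat \<Rightarrow> nat \<Rightarrow> nat list" where
  "family_exponents n r = [0, r, 2 * r - 2] @ map (a_exp r) [0..<Suc n]"

lemma set_family_exponents:
  "set (family_exponents n r) = {0, r, 2 * r - 2} \<union> a_exp r ` {..n}"
  by (auto simp: family_exponents_def simp del: upt_Suc)

lemma M_gens_eq: "M_gens n r = map (\<lambda>e. st_monom (a_exp r n - e) e) (family_exponents n r)"
  by (simp add: M_gens_def family_exponents_def b1_exp_def b2_exp_def)

lemma curve_family:
  assumes "1 \<le> n" "5 \<le> r"
  shows "projective_monomial_curve (family_exponents n r) (a_exp r n)"
proof
  let ?es = "family_exponents n r"
  have len: "length ?es = n + 4" by (simp add: family_exponents_def)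
  show "3 \<le> length ?es" "?es ! 0 = 0" using len by (simp_all add: family_exponents_def)
  show "?es ! (length ?es - 1) = a_exp r n"
    unfolding len by (simp add: family_exponents_def nth_append)
  show "0 < ?es ! k \<and> ?es ! k < a_exp r n" if k: "0 < k" "k < length ?es - 1" for k
  proof -
    from k(1) consider "k = 1" | "k = 2" | "3 \<le> k" by linarith
    then show ?thesis
    proof cases
      case 3
      define i where "i = k - 3"
      have i: "k = i + 3" "i < n" using 3 k(2) len by (simp_all add: i_def)
      then have "?es ! k = a_exp r i" by (simp add: family_exponents_def nth_append nth_map_upt del: upt_Suc)
      then show ?thesis using i assms by (simp add: a_exp_def)
    qed (use assms in \<open>simp_all add: family_exponents_def a_exp_def\<close>)
  qed
  show "\<exists>a\<in>set ?es. Suc a \<in> set ?es"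
    unfolding set_family_exponents
    by (rule bexI[of _ "2 * r - 2"]) (use assms in \<open>auto simp: a_exp_def image_iff intro!: bexI[of _ 0]\<close>)
qed

text \<open>
  With \<open>k\<close> summands \<open>a\<^sub>i = (2 r - 1) + 2 i\<close>, the sum of the indices \<open>i\<close> can be any number up to \<open>n k\<close>;
  greedily, each index is taken as large as possible.
\<close>
lemma sumset_arith_progression:
  assumes "0 < r" "w \<le> n * k"
  shows "k * (2 * r - 1) + 2 * w \<in> sumset (a_exp r ` {..n}) k"
  using assms(2)
proof (induction k arbitrary: w)
  case (Suc k)
  define i where "i = min n w"
  have "w - i \<le> n * k" using Suc.prems by (auto simp: i_def min_def)
  then have "k * (2 * r - 1) + 2 * (w - i) \<in> sumset (a_exp r ` {..n}) k" by (rule Suc.IH)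
  moreover have "a_exp r i \<in> a_exp r ` {..n}" by (simp add: i_def)
  moreover have "Suc k * (2 * r - 1) + 2 * w = a_exp r i + (k * (2 * r - 1) + 2 * (w - i))"
    using assms(1) by (simp add: a_exp_def i_def)
  ultimately show ?case unfolding sumset.simps by blast
qed simp

lemma sumset_mono: "E \<subseteq> E' \<Longrightarrow> sumset E d \<subseteq> sumset E' d"
  by (induction d) auto

text \<open>
  In a shortest expression of \<open>e\<close> no part can be exchanged for fewer exponents with the same sum. The
  exchanges \<open>4 b\<^sub>1 = a\<^sub>0 + a\<^sub>1\<close>, \<open>2 b\<^sub>1 + b\<^sub>2 = 2 a\<^sub>0\<close> and \<open>(2 r - 1) b\<^sub>2 = (2 r - 2) a\<^sub>0\<close> bound the numbers
  \<open>x\<close> of summands \<open>b\<^sub>1 = r\<close> and \<open>y\<close> of summands \<open>b\<^sub>2 = 2 r - 2\<close>. The summand \<open>0\<close> does not occur, and all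
  others are at least \<open>a\<^sub>0 = 2 r - 1\<close>, so the sum falls short of \<open>2 r - 1\<close> per summand by at most \<open>(r - 1) x + y\<close>, which
  is less than twice \<open>2 r - 1\<close>.
\<close>
lemma minimal_representation:
  assumes n: "1 \<le> n" and r: "5 \<le> r" and e: "e \<in> sumset (set (family_exponents n r)) M"
  shows "\<exists>m. e \<in> sumset (set (family_exponents n r)) m \<and> m * (2 * r - 1) \<le> e + 2 * (2 * r - 1)"
proof -
  let ?E = "set (family_exponents n r)"
  have E: "0 \<in> ?E" "r \<in> ?E" "2 * r - 2 \<in> ?E" "2 * r - 1 \<in> ?E" "2 * r + 1 \<in> ?E"
    using n r by (auto simp: set_family_exponents a_exp_def image_iff intro: bexI[of _ 0] bexI[of _ 1])
  define m where "m = (LEAST m. e \<in> sumset ?E m)"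
  have "e \<in> sumset ?E m" unfolding m_def using e by (rule LeastI)
  then obtain S where S: "set_mset S \<subseteq> ?E" "size S = m" "sum_mset S = e"
    by (auto simp: sumset_iff_mset)
  have no_shorter: False
    if "sum_mset A = sum_mset B" "A \<subseteq># S" "set_mset B \<subseteq> ?E" "size B < size A" for A B
  proof -
    have "S = A + (S - A)" using that(2) by simp
    then obtain S' where S': "S = A + S'" by blast
    have "e \<in> sumset ?E (size (B + S'))"
      unfolding sumset_iff_mset using S S' that by (intro exI[of _ "B + S'"]) auto
    then have "m \<le> size (B + S')" unfolding m_def by (rule Least_le)
    then show False using S(2) S' that(4) by simp
  qed
  have "0 \<notin># S"
    using no_shorter[of "{#0#}" "{#}"] by auto
  define x y where "x = count S r" and "y = count S (2 * r - 2)"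
  have sub: "replicate_mset a r + replicate_mset b (2 * r - 2) \<subseteq># S" if "a \<le> x" "b \<le> y" for a b
    using that r by (auto simp: subseteq_mset_def x_def y_def)
  have x: "x \<le> 3"
  proof (rule ccontr)
    assume "\<not> x \<le> 3"
    then have sub: "replicate_mset 4 r \<subseteq># S" using sub[of 4 0] by simp
    have "sum_mset (replicate_mset 4 r) = sum_mset {#2 * r - 1, 2 * r + 1#}"
      using r by simp
    from no_shorter[OF this sub] show False using E by simp
  qed
  have xy: "x \<le> 1 \<or> y = 0"
  proof (rule ccontr)
    assume "\<not> (x \<le> 1 \<or> y = 0)"
    then have sub: "replicate_mset 2 r + replicate_mset 1 (2 * r - 2) \<subseteq># S" by (intro sub) auto
    have "sum_mset (replicate_mset 2 r + replicate_mset 1 (2 * r - 2)) = sum_mset {#2 * r - 1, 2 * r - 1#}"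
      using r by (simp add: algebra_simps)
    from no_shorter[OF this sub] show False using E by simp
  qed
  have y: "y \<le> 2 * r - 2"
  proof (rule ccontr)
    assume "\<not> y \<le> 2 * r - 2"
    then have sub: "replicate_mset (2 * r - 1) (2 * r - 2) \<subseteq># S" using sub[of 0 "2 * r - 1"] by simp
    have eq: "sum_mset (replicate_mset (2 * r - 1) (2 * r - 2)) = sum_mset (replicate_mset (2 * r - 2) (2 * r - 1))"
      by (simp add: mult.commute)
    have "2 * r - 2 < 2 * r - 1" using r by linarith
    then show False using E by (intro no_shorter[OF eq sub]) auto
  qed
  have "(2 * r - 1) * size S' \<le> sum_mset S' + (r - 1) * count S' r + count S' (2 * r - 2)"
    if "\<And>a. a \<in># S' \<Longrightarrow> a = r \<or> a = 2 * r - 2 \<or> 2 * r - 1 \<le> a" for S'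
    using that
  proof (induction S')
    case (add a S')
    then have IH: "(2 * r - 1) * size S' \<le> sum_mset S' + (r - 1) * count S' r + count S' (2 * r - 2)"
      by auto
    have "a = r \<or> a = 2 * r - 2 \<or> 2 * r - 1 \<le> a" using add.prems by simp
    then show ?case
    proof (elim disjE)
      assume "a = r"
      then have "(r - 1) * count (add_mset a S') r = (r - 1) * count S' r + (r - 1)"
        "count S' (2 * r - 2) \<le> count (add_mset a S') (2 * r - 2)" "2 * r - 1 = a + (r - 1)"
        using r by simp_all
      then show ?thesis using IH unfolding size_add_mset sum_mset.add_mset mult_Suc_right by linarith
    next
      assume "a = 2 * r - 2"
      then have "(r - 1) * count S' r \<le> (r - 1) * count (add_mset a S') r"
        "count (add_mset a S') (2 * r - 2) = count S' (2 * r - 2) + 1" "2 * r - 1 = a + 1"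
        using r by simp_all
      then show ?thesis using IH unfolding size_add_mset sum_mset.add_mset mult_Suc_right by linarith
    next
      assume "2 * r - 1 \<le> a"
      moreover have "(r - 1) * count S' r \<le> (r - 1) * count (add_mset a S') r"
        "count S' (2 * r - 2) \<le> count (add_mset a S') (2 * r - 2)" by simp_all
      ultimately show ?thesis using IH unfolding size_add_mset sum_mset.add_mset mult_Suc_right by linarith
    qed
  qed simp
  moreover have "a = r \<or> a = 2 * r - 2 \<or> 2 * r - 1 \<le> a" if "a \<in># S" for a
    using that S(1) \<open>0 \<notin># S\<close> by (auto simp: set_family_exponents a_exp_def subset_iff)
  ultimately have "(2 * r - 1) * m \<le> e + (r - 1) * x + y"
    using S by (auto simp: x_def y_def)
  moreover have "(r - 1) * x + y \<le> 2 * (2 * r - 1)"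
  proof (cases "y = 0")
    case True
    have "(r - 1) * x \<le> (r - 1) * 3" using x by (rule mult_le_mono2)
    then show ?thesis using True r by linarith
  next
    case False
    then have "(r - 1) * x \<le> (r - 1) * 1" using xy by (intro mult_le_mono2) simp
    then show ?thesis using y r by linarith
  qed
  ultimately have "m * (2 * r - 1) \<le> e + 2 * (2 * r - 1)" by (simp add: mult.commute)
  then show ?thesis using \<open>e \<in> sumset ?E m\<close> by blast
qed

text \<open>
  The complementary exponents \<open>D - a\<close> are \<open>2 (n - i)\<close> for \<open>a\<^sub>i\<close>, \<open>2 n + 1\<close> for \<open>b\<^sub>2\<close>, and \<open>D\<close> and
  \<open>r + 2 n - 1\<close> for \<open>0\<close> and \<open>b\<^sub>1\<close>; each is even or at least \<open>2 n + 1\<close>, and this property is preserved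
  by addition.
\<close>
lemma codegree_of_sumset:
  assumes "5 \<le> r" "e \<in> sumset (set (family_exponents n r)) d"
  shows "e \<le> d * a_exp r n \<and> (even (d * a_exp r n - e) \<or> 2 * n + 1 \<le> d * a_exp r n - e)"
  using assms(2)
proof (induction d arbitrary: e)
  case (Suc d)
  then obtain a b where ab: "e = a + b" "a \<in> set (family_exponents n r)" "b \<in> sumset (set (family_exponents n r)) d"
    by auto
  have a: "a \<le> a_exp r n \<and> (even (a_exp r n - a) \<or> 2 * n + 1 \<le> a_exp r n - a)"
    using ab(2) assms(1) by (auto simp: set_family_exponents a_exp_def)
  note b = Suc.IH[OF ab(3)]
  have "Suc d * a_exp r n - e = (a_exp r n - a) + (d * a_exp r n - b)" "e \<le> Suc d * a_exp r n"
    using a b ab(1) by auto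
  then show ?case using a b by auto
qed simp

text \<open>
  Membership in the localization at \<open>t\<^sup>D\<close> makes \<open>f = d D - e\<close> even or at least \<open>2 n + 1\<close>. For \<open>f\<close> up to
  about \<open>2 n d\<close> the number \<open>e + D = (d + 1) D - f\<close> is written explicitly with \<open>d + 1\<close>
  summands. For larger \<open>f\<close>, membership in the localization at \<open>s\<^sup>D\<close> gives some expression of \<open>e\<close> and
  \<open>minimal_representation\<close> a short one.
\<close>
lemma H1_killed_by_st:
  assumes n: "1 \<le> n" and r: "5 \<le> r"
    and s: "curve_exponents.s_hits (set (family_exponents n r)) d e"
    and t: "curve_exponents.t_hits (set (family_exponents n r)) (a_exp r n) d e"
  shows "curve_exponents.hits (set (family_exponents n r)) (d + 2) (e + int (a_exp r n))"
proof -
  let ?E = "set (family_exponents n r)" and ?D = "a_exp r n"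
  interpret projective_monomial_curve "family_exponents n r" "a_exp r n"
    using n r by (rule curve_family)
  have D: "int ?D = 2 * int r - 1 + 2 * int n" using r by (simp add: a_exp_def of_nat_diff)
  have c: "int (2 * r - 1) = 2 * int r - 1" using r by (simp add: of_nat_diff)
  obtain k where k: "hits (d + int k) e" using s by (auto simp: s_hits_def)
  obtain l where l: "hits (d + int l) (e + int l * int ?D)" using t by (auto simp: t_hits_def)
  define f where "f = d * int ?D - e"
  have "nat (e + int l * int ?D) \<in> sumset ?E (nat (d + int l))" using l by (simp add: hits_def)
  from codegree_of_sumset[OF r this]
  have "even (nat (d + int l) * ?D - nat (e + int l * int ?D)) \<or>
      2 * n + 1 \<le> nat (d + int l) * ?D - nat (e + int l * int ?D)" by blast
  moreover have "f = int (nat (d + int l) * ?D - nat (e + int l * int ?D))"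
    using hits_le[OF l] hits_nonneg[OF l] by (simp add: f_def of_nat_diff nat_le_iff algebra_simps)
  ultimately have f: "0 \<le> f" "even f \<or> 2 * int n + 1 \<le> f" by auto
  have e0: "0 \<le> e" using hits_nonneg[OF k] by simp
  have d0: "0 \<le> d"
  proof (rule ccontr)
    assume "\<not> 0 \<le> d"
    then have "d * int ?D < 0" using D_positive by (simp add: mult_neg_pos)
    then show False using f e0 by (simp add: f_def)
  qed
  have progression: "hits (int k) (int k * (2 * int r - 1) + 2 * int w)" if "w \<le> n * k" for k w
  proof -
    have "k * (2 * r - 1) + 2 * w \<in> sumset ?E k"
      using sumset_arith_progression[OF _ that, of r] r
        sumset_mono[of "a_exp r ` {..n}" ?E k] by (auto simp: set_family_exponents)
    then show ?thesis using c by (simp add: hits_def nat_add_distrib nat_mult_distrib flip: c)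
  qed
  consider (even) "even f" "f \<le> 2 * int n * (d + 1)"
    | (odd) "odd f" "f \<le> 2 * int n * d + 2 * int n + 1"
    | (large) "2 * int n * (d + 1) < f" by (cases "even f") (force simp: algebra_simps)+
  then show ?thesis
  proof cases
    case even
    \<comment> \<open>the sum of the indices \<open>i\<close> of \<open>d + 1\<close> summands \<open>a\<^sub>i\<close>, which are smaller than \<open>(d + 1) D\<close> by \<open>f\<close> in total\<close>
    define w where "w = nat (int n * (d + 1) - f div 2)"
    have w: "2 * int w = 2 * int n * (d + 1) - f" "w \<le> n * nat (d + 1)"
      using even f(1) d0 by (auto simp: w_def nat_le_iff elim!: evenE)
    have "int (nat (d + 1)) * (2 * int r - 1) + 2 * int w = e + int ?D"
      unfolding w(1) f_def D using d0 by (simp add: algebra_simps)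
    with progression[OF w(2)] have "hits (d + 1) (e + int ?D)" using d0 by simp
    from hits_s[OF this, of 1] show ?thesis by (simp add: add.assoc)
  next
    case odd
    \<comment> \<open>the sum of the indices of \<open>d\<close> summands \<open>a\<^sub>i\<close>; \<open>b\<^sub>2 = D - (2 n + 1)\<close> accounts for the odd part of \<open>f\<close>\<close>
    define w where "w = nat ((2 * int n * d + 2 * int n + 1 - f) div 2)"
    have "2 * int n + 1 \<le> f" using odd(1) f(2) by blast
    then have w: "2 * int w = 2 * int n * d + 2 * int n + 1 - f" "w \<le> n * nat d"
      using odd d0 by (auto simp: w_def nat_le_iff elim!: oddE)
    have "2 * r - 2 \<in> ?E" by (simp add: set_family_exponents)
    from hits_mult[OF this, of 1] have "hits 1 (2 * int r - 2)" using r by (simp add: of_nat_diff)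
    note hits_add[OF this progression[OF w(2)]]
    moreover have "2 * int r - 2 + (int (nat d) * (2 * int r - 1) + 2 * int w) = e + int ?D"
      unfolding w(1) f_def D using d0 by (simp add: algebra_simps)
    ultimately have "hits (d + 1) (e + int ?D)" using d0 by (simp add: add.commute)
    from hits_s[OF this, of 1] show ?thesis by (simp add: add.assoc)
  next
    case large
    have "nat e \<in> sumset ?E (nat (d + int k))" using k by (simp add: hits_def)
    from minimal_representation[OF n r this] obtain m where
      m: "nat e \<in> sumset ?E m" "m * (2 * r - 1) \<le> nat e + 2 * (2 * r - 1)" by blast
    have "int (m * (2 * r - 1)) \<le> int (nat e + 2 * (2 * r - 1))" using m(2) by (simp only: of_nat_le_iff)
    then have "int m * (2 * int r - 1) \<le> e + 2 * (2 * int r - 1)" using e0 c by simp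
    moreover have "e < d * (2 * int r - 1)" using large by (simp add: f_def D algebra_simps)
    ultimately have "int m * (2 * int r - 1) < (d + 2) * (2 * int r - 1)" by (simp add: distrib_right)
    then have "int m \<le> d + 1" using r by simp
    moreover have "hits (int m) e" using m(1) e0 by (simp add: hits_def)
    ultimately have "hits (d + 1) e" using hits_s[of "int m" e "d + 1 - int m"] by simp
    from hits_t[OF this, of 1] show ?thesis by (simp add: add.assoc)
  qed
qed

theorem theorem5p7:
  fixes n r :: nat
    and R :: "int \<Rightarrow> 'k::field poly poly set"
    and M :: "'k poly poly list"
    and Q :: "'k poly poly set"
  defines "R \<equiv> R_component n r"
    and "M \<equiv> M_gens n r"
    and "Q \<equiv> Q_ideal n r"
  assumes "n \<ge> 1" and "r \<ge> 5"
  shows "(\<exists>m. R (int m + 1) = Q \<inter> R (int m + 1)) \<and>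
         (\<exists>d\<in>regularity_degrees R M. \<forall>d'\<in>regularity_degrees R M. d' \<le> d) \<and>
         regularity R M = int (reduction_number R Q)"
proof -
  interpret projective_monomial_curve "family_exponents n r" "a_exp r n"
    using assms(4,5) by (rule curve_family)
  have M: "M = gens" by (simp add: M_def M_gens_eq gens_def)
  have R: "R = component"
    by (rule ext) (simp add: R_def R_component_def component_def M_gens_eq gens_def)
  have Q: "Q = end_ideal"
    by (simp add: Q_def Q_ideal_def end_ideal_def R_ring_def curve_ring_def M_gens_eq gens_def)
  show ?thesis
    unfolding M R Q using H1_killed_by_st[OF assms(4,5)] by (rule regularity_eq_reduction_number)
qed

end
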